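(* Let $\nu > 1$. There exist positive constants $c(\nu), c'(\nu)$ depending only on $\nu$, with $c'(\nu)\ge \min \{t\ge e: \nu\log(t) > c(\nu)\log\log(t)\}$, such that the following holds for all $\sigma>0$, $a>0$ and integers $1\le s<d$. (i) If $\min(d-s,s)>c'(\nu)$ and $$a <\sigma \Big( (\nu\log (d-s) - c(\nu)\log\log (d-s) )^{1/\nu} + (\nu\log(s) - c(\nu)\log\log(s) )^{1/\nu} \Big),$$ then $$\inf_{\tilde{\eta}}\sup_{F \in \mathcal{P}_\nu} \sup_{\mu \in \Theta_{d} (s,a)} \mathbf{E}_{\mu,F} |\tilde{\eta} - \eta(\mu)| \ge \inf_{\tilde{\eta}} \sup_{F \in \mathcal{P}_\nu} \sup_{\mu \in \Theta_{d} (s,a)}\mathbf{P}_{\mu,F} (S_{\tilde\eta} \ne S_{\eta(\mu)}) \ge (1-e^{-1})^2.$$ (ii) If for some $A>1$ we have $\min(d/s-1,A)>c'(\nu)$ and $$a < \sigma \Big((\nu\log (d/s-1) - c(\nu)\log\log (d/s-1) )^{1/\nu} + (\nu\log(A) - c(\nu)\log\log(A) )^{1/\nu} \Big),$$ then $$\inf_{\tilde{\eta}} \sup_{F \in \mathcal{P}_\nu} \sup_{\mu \in \Theta_{d} (s,a)} \frac{1}{s}\mathbf{E}_{\mu,F} |\tilde{\eta} - \eta(\mu)| \geq \frac{1-e^{-1}}{A}.$$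
   Context: Location model: one observes $X_i=\mu_i+\sigma\xi_i$, $i=1,\dots,d$ ($d>2$), where $\sigma>0$ and $\xi_1,\dots,\xi_d$ are i.i.d. with c.d.f. $F$. For $\nu\ge1$, $$\mathcal{P}_\nu=\{F:\mathbb{R}\to[0,1]\ \text{c.d.f.}:\ 1-F(u)\le e^{-|u|^\nu/\nu}\ \text{and}\ F(-u)\le e^{-|u|^\nu/\nu}\ \ \forall u\ge0\}.$$ For $a>0$ and integer $1\le s<d$, $$\Theta_d(s,a)=\{\mu\in\mathbb{R}^d:\ \exists S\subset\{1,\dots,d\},\ |S|=s,\ \mu_j\ge a\ \text{for } j\in S,\ \mu_j=0\ \text{for } j\notin S\}.$$ For $\mu\in\Theta_d(s,a)$, $\eta(\mu)\in\{0,1\}^d$ has components $\eta_j(\mu)=\mathbf{1}(\mu_j\neq0)$. $\mathbf{P}_{\mu,F}$, $\mathbf{E}_{\mu,F}$ are the probability and expectation for the observations $(X_1,\dots,X_d)$. A selector is a measurable function $\tilde\eta$ of $(X_1,\dots,X_d)$, possibly randomized (i.e. also depending on a random variable independent of the data), with values in $\{0,1\}^d$; $\inf_{\tilde\eta}$ is over all selectors. $|\tilde\eta-\eta|=\sum_{j=1}^d\mathbf{1}(\tilde\eta_j\neq\eta_j)$ and $S_\eta=\{j:\eta_j\neq0\}$. *)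

theory Defs
  imports "HOL-Probability.Probability"
begin

definition cdf_class :: "real \<Rightarrow> (real \<Rightarrow> real) set" where
  "cdf_class \<nu> = {F. (\<exists>M. real_distribution M \<and> F = cdf M) \<and>
     (\<forall>u\<ge>0. 1 - F u \<le> exp (- (\<bar>u\<bar> powr \<nu>) / \<nu>) \<and> F (- u) \<le> exp (- (\<bar>u\<bar> powr \<nu>) / \<nu>))}"

text \<open>Vectors indexed by \<open>{1..d}\<close> are extensional functions on \<open>{1..d}\<close>.\<close>

definition sparse_means :: "nat \<Rightarrow> nat \<Rightarrow> real \<Rightarrow> (nat \<Rightarrow> real) set" where
  "sparse_means d s a = {\<mu> \<in> {1..d} \<rightarrow>\<^sub>E UNIV.
     \<exists>S\<subseteq>{1..d}. card S = s \<and> (\<forall>j\<in>S. \<mu> j \<ge> a) \<and> (\<forall>j\<in>{1..d} - S. \<mu> j = 0)}"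

definition pattern :: "nat \<Rightarrow> (nat \<Rightarrow> real) \<Rightarrow> nat \<Rightarrow> nat" where
  "pattern d \<mu> = (\<lambda>j\<in>{1..d}. of_bool (\<mu> j \<noteq> 0))"

definition supp :: "nat \<Rightarrow> (nat \<Rightarrow> nat) \<Rightarrow> nat set" where
  "supp d \<eta> = {j\<in>{1..d}. \<eta> j \<noteq> 0}"

definition hamming :: "nat \<Rightarrow> (nat \<Rightarrow> nat) \<Rightarrow> (nat \<Rightarrow> nat) \<Rightarrow> nat" where
  "hamming d \<eta> \<eta>' = (\<Sum>j=1..d. of_bool (\<eta> j \<noteq> \<eta>' j))"

text \<open>The law of \<open>(X\<^sub>1, \<dots>, X\<^sub>d)\<close> with \<open>X\<^sub>i = \<mu>\<^sub>i + \<sigma> \<xi>\<^sub>i\<close>, where the \<open>\<xi>\<^sub>i\<close> are i.i.d.\ with c.d.f. \<open>F\<close>;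
  for a c.d.f. \<open>F\<close>, \<open>interval_measure F\<close> is the probability measure on the line with c.d.f. \<open>F\<close>.\<close>

definition obs_law :: "nat \<Rightarrow> real \<Rightarrow> (nat \<Rightarrow> real) \<Rightarrow> (real \<Rightarrow> real) \<Rightarrow> (nat \<Rightarrow> real) measure" where
  "obs_law d \<sigma> \<mu> F = distr (PiM {1..d} (\<lambda>_. interval_measure F)) (PiM {1..d} (\<lambda>_. borel))
     (\<lambda>\<xi>. \<lambda>i\<in>{1..d}. \<mu> i + \<sigma> * \<xi> i)"

text \<open>A (possibly randomized) selector is a pair \<open>(R, \<eta>)\<close>: \<open>\<eta>\<close> is a measurable function of \<open>(X, U)\<close>
  with values in \<open>{0, 1}\<^sup>d\<close>, where \<open>U\<close> is a real random variable with arbitrary law \<open>R\<close>, independent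
  of \<open>X\<close>. Functions that ignore \<open>U\<close> are the non-randomized selectors.\<close>

definition selectors :: "nat \<Rightarrow> (real measure \<times> ((nat \<Rightarrow> real) \<times> real \<Rightarrow> nat \<Rightarrow> nat)) set" where
  "selectors d = {(R, \<eta>). real_distribution R \<and>
     \<eta> \<in> PiM {1..d} (\<lambda>_. borel) \<Otimes>\<^sub>M borel \<rightarrow>\<^sub>M count_space ({1..d} \<rightarrow>\<^sub>E {0, 1})}"

text \<open>Expectation and probability are taken under the joint law of \<open>(X, U)\<close>; they are valued in
  \<open>ennreal\<close> so that infima and suprema are taken in a complete lattice.\<close>

definition hamming_risk ::
    "nat \<Rightarrow> real \<Rightarrow> real measure \<times> ((nat \<Rightarrow> real) \<times> real \<Rightarrow> nat \<Rightarrow> nat)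
      \<Rightarrow> (nat \<Rightarrow> real) \<Rightarrow> (real \<Rightarrow> real) \<Rightarrow> ennreal" where
  "hamming_risk d \<sigma> = (\<lambda>(R, \<eta>) \<mu> F.
     \<integral>\<^sup>+ \<omega>. of_nat (hamming d (\<eta> \<omega>) (pattern d \<mu>)) \<partial>(obs_law d \<sigma> \<mu> F \<Otimes>\<^sub>M R))"

definition wrong_recovery_prob ::
    "nat \<Rightarrow> real \<Rightarrow> real measure \<times> ((nat \<Rightarrow> real) \<times> real \<Rightarrow> nat \<Rightarrow> nat)
      \<Rightarrow> (nat \<Rightarrow> real) \<Rightarrow> (real \<Rightarrow> real) \<Rightarrow> ennreal" where
  "wrong_recovery_prob d \<sigma> = (\<lambda>(R, \<eta>) \<mu> F.
     emeasure (obs_law d \<sigma> \<mu> F \<Otimes>\<^sub>M R)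
       {\<omega> \<in> space (obs_law d \<sigma> \<mu> F \<Otimes>\<^sub>M R). supp d (\<eta> \<omega>) \<noteq> supp d (pattern d \<mu>)})"

end

theory Submission
  imports Defs "HOL-Combinatorics.Transposition"
begin

text \<open>
  The least favourable noise has three atoms \<open>x0\<close>, \<open>- x1\<close> and \<open>0\<close> with
  \<open>\<sigma> * (x0 + x1) = a\<close>: a null coordinate with noise \<open>x0\<close> and a signal of height \<open>a\<close> with noise
  \<open>- x1\<close> are observed at the same point. For \<open>c = \<nu>\<close>, the bound on \<open>a\<close> and the tail condition allow
  the masses \<open>ln t / t\<close>, where \<open>t\<close> is \<open>d - s\<close> and \<open>s\<close> in (i), and \<open>d / s - 1\<close> and \<open>A\<close> in (ii); the
  factor \<open>ln t\<close> absorbs all constants. Put the uniform prior on the supports \<open>S\<close> of size \<open>s\<close>.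
  Exchanging such a null and such a signal, in the support and in the noise, leaves the joint law
  and the observation unchanged, so no selector can tell the two apart. Hence recovery fails with at
  least half the probability that both kinds of coordinates occur, and the Hamming risk is at least
  the expected minimum of their two counts.
\<close>

subsection \<open>Exchanging confused coordinates\<close>

abbreviation swap :: "nat \<Rightarrow> nat \<Rightarrow> nat \<Rightarrow> nat" where
  "swap \<equiv> Transposition.transpose"

text \<open>The exchange argument uses only the relation \<open>shift\<close>. The masses of
  \<open>x0\<close> and \<open>- x1\<close> under \<open>Q\<close> stay free until the confused
  coordinates are counted.\<close>

locale confusable_noise = real_distribution Q for Q :: "real measure" +
  fixes D :: "nat set" and \<sigma> a x0 x1 :: real
  assumes finite_D: "finite D" and shift: "a = \<sigma> * (x0 + x1)"
begin

abbreviation P :: "(nat \<Rightarrow> real) measure" where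
  "P \<equiv> PiM D (\<lambda>_. Q)"

definition obs :: "nat set \<Rightarrow> (nat \<Rightarrow> real) \<Rightarrow> nat \<Rightarrow> real" where
  "obs S \<xi> = (\<lambda>k\<in>D. a * of_bool (k \<in> S) + \<sigma> * \<xi> k)"

text \<open>Signals pulled down by their noise; \<open>high\<close> collects the nulls pushed up to
  the same observed value.\<close>

definition low :: "nat set \<Rightarrow> (nat \<Rightarrow> real) \<Rightarrow> nat set" where
  "low S \<xi> = {k\<in>S. \<xi> k = - x1}"

definition high :: "nat set \<Rightarrow> (nat \<Rightarrow> real) \<Rightarrow> nat set" where
  "high S \<xi> = {k\<in>D - S. \<xi> k = x0}"

text \<open>The weight depends on the noise only through the confused pair and the two counts, so it
  survives a transposition. Leaving \<open>v\<close> open lets one exchange bound serve both risks: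
  \<open>1 / (m * n)\<close> for support recovery, \<open>1 / max m n\<close> for the Hamming
  loss.\<close>

definition pair_weight ::
    "(nat \<Rightarrow> nat \<Rightarrow> ennreal) \<Rightarrow> nat set \<Rightarrow> nat \<Rightarrow> nat \<Rightarrow> (nat \<Rightarrow> real) \<Rightarrow> ennreal" where
  "pair_weight v S i j \<xi> =
     of_bool (\<xi> i = - x1 \<and> \<xi> j = x0) * v (card (low S \<xi>)) (card (high S \<xi>))"

definition sized :: "nat \<Rightarrow> nat set set" where
  "sized s = {S. S \<subseteq> D \<and> card S = s}"

section \<open>Finiteness and measurability of the confused counts\<close>

lemma finite_sized: "finite (sized s)"
  unfolding sized_def using finite_D by auto

lemma finite_low: "S \<subseteq> D \<Longrightarrow> finite (low S \<xi>)"
  and finite_high: "finite (high S \<xi>)"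
  unfolding low_def high_def using finite_D by (auto intro: finite_subset)

lemma obs_measurable [measurable]: "obs S \<in> P \<rightarrow>\<^sub>M PiM D (\<lambda>_. borel)"
  unfolding obs_def by (intro measurable_restrict) simp

lemma coordinate_measurable: "k \<in> D \<Longrightarrow> (\<lambda>\<xi>. \<xi> k) \<in> borel_measurable P"
  using measurable_component_singleton[of k D "\<lambda>_. Q"] by simp

lemma coordinate_eq_measurable: "k \<in> D \<Longrightarrow> Measurable.pred P (\<lambda>\<xi>. \<xi> k = c)"
  using coordinate_measurable[of k] by measurable

lemma card_low_measurable [measurable]:
  assumes "S \<subseteq> D"
  shows "(\<lambda>\<xi>. card (low S \<xi>)) \<in> P \<rightarrow>\<^sub>M count_space UNIV"
proof (rule measurable_card)
  fix i
  show "{\<xi> \<in> space P. i \<in> low S \<xi>} \<in> sets P"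
  proof (cases "i \<in> S")
    case True
    with assms coordinate_eq_measurable[of i "- x1"] show ?thesis
      by (auto simp: low_def pred_def)
  qed (simp add: low_def)
qed

lemma card_high_measurable [measurable]:
  "(\<lambda>\<xi>. card (high S \<xi>)) \<in> P \<rightarrow>\<^sub>M count_space UNIV"
proof (rule measurable_card)
  fix i
  show "{\<xi> \<in> space P. i \<in> high S \<xi>} \<in> sets P"
  proof (cases "i \<in> D - S")
    case True
    with coordinate_eq_measurable[of i x0] show ?thesis
      by (auto simp: high_def pred_def)
  qed (auto simp: high_def)
qed

lemma pair_weight_measurable:
  assumes "S \<subseteq> D" "i \<in> D" "j \<in> D"
  shows "pair_weight v S i j \<in> borel_measurable P"
proof -
  note [measurable] = card_low_measurable[OF assms(1)]
    coordinate_eq_measurable[OF assms(2)] coordinate_eq_measurable[OF assms(3)]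
  show ?thesis
    unfolding pair_weight_def of_bool_def by measurable
qed

text \<open>The coordinates are i.i.d., so reindexing them by a permutation of \<open>D\<close>
  preserves the product law.\<close>

lemma nn_integral_transpose:
  assumes "i \<in> D" "j \<in> D" and f: "f \<in> borel_measurable P"
  shows "(\<integral>\<^sup>+\<xi>. f \<xi> \<partial>P) = (\<integral>\<^sup>+\<xi>. f (\<lambda>k\<in>D. \<xi> (swap i j k)) \<partial>P)"
proof -
  have maps: "swap i j \<in> D \<rightarrow> D" "inj_on (swap i j) D"
    using assms by (auto simp: Transposition.transpose_def inj_on_def)
  have m: "(\<lambda>\<xi>. \<lambda>k\<in>D. \<xi> (swap i j k)) \<in> P \<rightarrow>\<^sub>M P"
    using maps by (intro measurable_restrict measurable_component_singleton) auto
  have "distr P P (\<lambda>\<xi>. \<lambda>k\<in>D. \<xi> (swap i j k)) = P"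
    using distr_PiM_reindex[OF _ maps(2,1), of "\<lambda>_. Q"] prob_space_axioms by simp
  then have "(\<integral>\<^sup>+\<xi>. f \<xi> \<partial>P) = (\<integral>\<^sup>+\<xi>. f \<xi> \<partial>distr P P (\<lambda>\<xi>. \<lambda>k\<in>D. \<xi> (swap i j k)))"
    by simp
  also have "\<dots> = (\<integral>\<^sup>+\<xi>. f (\<lambda>k\<in>D. \<xi> (swap i j k)) \<partial>P)"
    using f by (subst nn_integral_distr[OF m]) simp_all
  finally show ?thesis .
qed

section \<open>Transpositions acting on supports, counts and observations\<close>

lemma transpose_image:
  assumes "i \<in> S" "j \<notin> S"
  shows "swap i j ` S = insert j (S - {i})"
  using assms by (auto simp: Transposition.transpose_def image_iff)

text \<open>These facts make the exchange of a signal with a null an involution on triples of a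
  support, a signal and a null. The inequality of the two supports is what prevents an answer from
  being right for both.\<close>

lemma transpose_sized:
  assumes "S \<in> sized s" "i \<in> S" "j \<in> D - S"
  shows "swap i j ` S \<in> sized s"
    and "swap i j ` S \<noteq> S"
    and "j \<in> swap i j ` S" and "i \<in> D - swap i j ` S"
    and "swap j i ` swap i j ` S = S"
proof -
  have S: "S \<subseteq> D" "card S = s" using assms by (auto simp: sized_def)
  have im: "swap i j ` S = insert j (S - {i})" using assms by (intro transpose_image) auto
  have "card (swap i j ` S) = s"
    using S by (subst card_image) auto
  then show "swap i j ` S \<in> sized s" using S assms im by (auto simp: sized_def)
  show "swap i j ` S \<noteq> S" "j \<in> swap i j ` S" "i \<in> D - swap i j ` S"
    using S assms im by auto
  show "swap j i ` swap i j ` S = S"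
    by (simp add: Transposition.transpose_commute[of j i] image_image)
qed

lemma mem_swap_image: "l \<in> swap i j ` A \<longleftrightarrow> swap i j l \<in> A"
  by (metis image_iff transpose_involutory)

lemma swap_mem_iff: "i \<in> D \<Longrightarrow> j \<in> D \<Longrightarrow> swap i j k \<in> D \<longleftrightarrow> k \<in> D"
  by (auto simp: Transposition.transpose_def)

text \<open>Support and noise are relabelled together, so the confused signals are just carried
  along by an injective map.\<close>

lemma card_low_transpose:
  assumes "S \<subseteq> D" "i \<in> D" "j \<in> D"
  shows "card (low (swap i j ` S) (\<lambda>k\<in>D. \<xi> (swap i j k))) = card (low S \<xi>)"
proof -
  have "low (swap i j ` S) (\<lambda>k\<in>D. \<xi> (swap i j k)) = swap i j ` low S \<xi>"
    using assms swap_mem_iff[of i j]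
    unfolding set_eq_iff mem_swap_image low_def mem_Collect_eq by auto
  then show ?thesis by (simp add: card_image)
qed

lemma card_high_transpose:
  assumes "i \<in> D" "j \<in> D"
  shows "card (high (swap i j ` S) (\<lambda>k\<in>D. \<xi> (swap i j k))) = card (high S \<xi>)"
proof -
  have "high (swap i j ` S) (\<lambda>k\<in>D. \<xi> (swap i j k)) = swap i j ` high S \<xi>"
    using assms swap_mem_iff[of i j]
    unfolding set_eq_iff mem_swap_image high_def mem_Collect_eq Diff_iff by auto
  then show ?thesis by (simp add: card_image)
qed

lemma pair_weight_transpose:
  assumes "S \<subseteq> D" "i \<in> D" "j \<in> D"
  shows "pair_weight v (swap i j ` S) j i (\<lambda>k\<in>D. \<xi> (swap i j k)) = pair_weight v S i j \<xi>"
  using assms card_low_transpose[OF assms] card_high_transpose[OF assms(2,3)]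
  by (simp add: pair_weight_def)

text \<open>Only coordinates \<open>i\<close> and \<open>j\<close> could change. Before and after
  the exchange both show \<open>\<sigma> * x0\<close>, which equals \<open>a - \<sigma> * x1\<close>
  by \<open>shift\<close>.\<close>

lemma obs_transpose:
  assumes "i \<in> S" "j \<in> D - S" "S \<subseteq> D" "\<xi> i = - x1" "\<xi> j = x0"
  shows "obs (swap i j ` S) (\<lambda>k\<in>D. \<xi> (swap i j k)) = obs S \<xi>"
proof -
  have im: "swap i j ` S = insert j (S - {i})" using assms by (intro transpose_image) auto
  show ?thesis
    unfolding obs_def im
  proof (rule restrict_ext)
    fix k assume "k \<in> D"
    consider "k = i" | "k = j" | "k \<noteq> i" "k \<noteq> j" by blast
    then show "a * of_bool (k \<in> insert j (S - {i})) + \<sigma> * (\<lambda>k\<in>D. \<xi> (swap i j k)) k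
        = a * of_bool (k \<in> S) + \<sigma> * \<xi> k"
      using assms \<open>k \<in> D\<close> by cases (auto simp: shift algebra_simps)
  qed
qed

text \<open>The indicator of a confused pair factorises into a condition on \<open>i\<close> and one
  on \<open>j\<close>, so the double sum is a product of two counts.\<close>

lemma sum_pair_weight:
  assumes "S \<subseteq> D"
  shows "(\<Sum>i\<in>S. \<Sum>j\<in>D - S. pair_weight v S i j \<xi>)
    = of_nat (card (low S \<xi>) * card (high S \<xi>)) * v (card (low S \<xi>)) (card (high S \<xi>))"
proof -
  let ?v = "v (card (low S \<xi>)) (card (high S \<xi>))"
  have fin: "finite S" using assms finite_D finite_subset by blast
  have "(\<Sum>i\<in>S. \<Sum>j\<in>D - S. pair_weight v S i j \<xi>)
      = (\<Sum>i\<in>S. \<Sum>j\<in>D - S. of_bool (\<xi> i = - x1) * of_bool (\<xi> j = x0) * ?v)"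
    by (simp add: pair_weight_def of_bool_conj)
  also have "\<dots> = (\<Sum>i\<in>S. of_bool (\<xi> i = - x1)) * (\<Sum>j\<in>D - S. of_bool (\<xi> j = x0)) * ?v"
    by (subst sum_product) (simp only: sum_distrib_right)
  also have "(\<Sum>i\<in>S. of_bool (\<xi> i = - x1)) = (of_nat (card (low S \<xi>)) :: ennreal)"
    using fin by (subst sum_of_bool_eq) (auto simp: low_def Int_def)
  also have "(\<Sum>j\<in>D - S. of_bool (\<xi> j = x0)) = (of_nat (card (high S \<xi>)) :: ennreal)"
    using finite_D by (subst sum_of_bool_eq) (auto simp: high_def Int_def)
  finally show ?thesis by simp
qed

text \<open>Relabelling by the transposition of \<open>i\<close> and \<open>j\<close> preserves the noise law and, where
  \<open>pair_weight\<close> is nonzero, the observation; so each loss can be paired with its transposed copy.\<close>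

lemma exchange_bound:
  fixes \<kappa> :: ennreal and \<rho> :: "nat set \<Rightarrow> (nat \<Rightarrow> real) \<Rightarrow> ennreal"
  assumes meas: "\<And>S i j. loss S i j \<in> borel_measurable (PiM D (\<lambda>_. borel))"
    and dich: "\<And>S i j y. S \<in> sized s \<Longrightarrow> i \<in> S \<Longrightarrow> j \<in> D - S \<Longrightarrow> y \<in> space (PiM D (\<lambda>_. borel)) \<Longrightarrow>
      \<kappa> \<le> loss S i j y + loss (swap i j ` S) j i y"
    and dom: "\<And>S \<xi>. S \<in> sized s \<Longrightarrow> \<xi> \<in> space P \<Longrightarrow>
      (\<Sum>i\<in>S. \<Sum>j\<in>D - S. pair_weight v S i j \<xi> * loss S i j (obs S \<xi>)) \<le> \<rho> S (obs S \<xi>)"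
  shows "(\<Sum>S\<in>sized s. \<integral>\<^sup>+\<xi>. \<kappa> * (of_nat (card (low S \<xi>) * card (high S \<xi>))
              * v (card (low S \<xi>)) (card (high S \<xi>))) \<partial>P)
    \<le> 2 * (\<Sum>S\<in>sized s. \<integral>\<^sup>+\<xi>. \<rho> S (obs S \<xi>) \<partial>P)"
proof -
  \<comment> \<open>Both sides are rewritten as sums over triples of a support, one of its signals
    and one of its nulls; \<open>\<tau>\<close> exchanges the two coordinates.\<close>
  define T where "T = (SIGMA S:sized s. S \<times> (D - S))"
  define I where "I = (\<lambda>(S, i, j). \<integral>\<^sup>+\<xi>. pair_weight v S i j \<xi> * loss S i j (obs S \<xi>) \<partial>P)"
  define \<tau> where "\<tau> = (\<lambda>(S :: nat set, i :: nat, j :: nat). (swap i j ` S, j, i))"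
  have sub: "S \<subseteq> D" "finite S" if "S \<in> sized s" for S
    using that finite_D finite_subset by (auto simp: sized_def)
  have pw: "pair_weight v S i j \<in> borel_measurable P" if "(S, i, j) \<in> T" for S i j
    using that sub by (intro pair_weight_measurable) (auto simp: T_def)
  have lo: "(\<lambda>\<xi>. loss S i j (obs S' \<xi>)) \<in> borel_measurable P" for S S' i j
    using measurable_compose[OF obs_measurable meas] .
  have sumT: "(\<Sum>t\<in>T. g t) = (\<Sum>S\<in>sized s. \<Sum>i\<in>S. \<Sum>j\<in>D - S. g (S, i, j))"
    for g :: "_ \<Rightarrow> ennreal"
  proof -
    have "(\<Sum>t\<in>T. g t) = (\<Sum>S\<in>sized s. \<Sum>p\<in>S \<times> (D - S). g (S, p))"
      unfolding T_def using finite_sized sub finite_D by (subst sum.Sigma) auto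
    then show ?thesis by (simp add: sum.cartesian_product)
  qed
  have \<tau>_T: "\<tau> t \<in> T \<and> \<tau> (\<tau> t) = t" if t: "t \<in> T" for t
  proof -
    obtain S i j where t_eq: "t = (S, i, j)" by (cases t)
    with t have S: "S \<in> sized s" "i \<in> S" "j \<in> D - S" by (auto simp: T_def)
    note * = transpose_sized[OF S]
    show ?thesis
      unfolding t_eq \<tau>_def T_def split using S *(1,3,4,5) by (intro conjI SigmaI) simp_all
  qed
  have swap_sums: "(\<integral>\<^sup>+\<xi>. (\<Sum>i\<in>S. \<Sum>j\<in>D - S. h i j \<xi>) \<partial>P)
      = (\<Sum>i\<in>S. \<Sum>j\<in>D - S. \<integral>\<^sup>+\<xi>. h i j \<xi> \<partial>P)"
    if "\<And>i j. i \<in> S \<Longrightarrow> j \<in> D - S \<Longrightarrow> h i j \<in> borel_measurable P"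
    for S and h :: "_ \<Rightarrow> _ \<Rightarrow> _ \<Rightarrow> ennreal"
  proof -
    have "(\<integral>\<^sup>+\<xi>. (\<Sum>i\<in>S. \<Sum>j\<in>D - S. h i j \<xi>) \<partial>P)
        = (\<Sum>i\<in>S. \<integral>\<^sup>+\<xi>. (\<Sum>j\<in>D - S. h i j \<xi>) \<partial>P)"
      using that by (intro nn_integral_sum borel_measurable_sum) auto
    also have "\<dots> = (\<Sum>i\<in>S. \<Sum>j\<in>D - S. \<integral>\<^sup>+\<xi>. h i j \<xi> \<partial>P)"
      using that by (intro sum.cong refl nn_integral_sum) auto
    finally show ?thesis .
  qed
  have pairing: "(\<integral>\<^sup>+\<xi>. \<kappa> * pair_weight v S i j \<xi> \<partial>P) \<le> I (S, i, j) + I (\<tau> (S, i, j))"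
    if t: "(S, i, j) \<in> T" for S i j
  proof -
    have S: "S \<in> sized s" "i \<in> S" "j \<in> D - S" "S \<subseteq> D" "i \<in> D"
      using t sub by (auto simp: T_def)
    let ?S = "swap i j ` S"
    have t': "(?S, j, i) \<in> T"
      using transpose_sized[OF S(1-3)] by (auto simp: T_def)
    \<comment> \<open>Changing variables by the transposition gives the exchanged term the same
      weight and the same observation as the original one, so \<open>dich\<close> can be applied
      under a single integral.\<close>
    have "I (\<tau> (S, i, j)) = (\<integral>\<^sup>+\<xi>. pair_weight v ?S j i \<xi> * loss ?S j i (obs ?S \<xi>) \<partial>P)"
      by (simp add: I_def \<tau>_def)
    also have "\<dots> = (\<integral>\<^sup>+\<xi>. pair_weight v ?S j i (\<lambda>k\<in>D. \<xi> (swap i j k))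
        * loss ?S j i (obs ?S (\<lambda>k\<in>D. \<xi> (swap i j k))) \<partial>P)"
      using S pw[OF t'] lo by (intro nn_integral_transpose) auto
    also have "\<dots> = (\<integral>\<^sup>+\<xi>. pair_weight v S i j \<xi> * loss ?S j i (obs S \<xi>) \<partial>P)"
    proof (rule nn_integral_cong)
      fix \<xi>
      show "pair_weight v ?S j i (\<lambda>k\<in>D. \<xi> (swap i j k))
          * loss ?S j i (obs ?S (\<lambda>k\<in>D. \<xi> (swap i j k)))
        = pair_weight v S i j \<xi> * loss ?S j i (obs S \<xi>)"
      proof (cases "\<xi> i = - x1 \<and> \<xi> j = x0")
        case True
        then show ?thesis
          using S obs_transpose[of i S j \<xi>] pair_weight_transpose[of S i j v \<xi>] by simp
      next
        \<comment> \<open>The two observations may differ here, but both weights are 0.\<close>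
        case False
        then have "pair_weight v S i j \<xi> = 0" by (auto simp: pair_weight_def)
        then show ?thesis
          using S pair_weight_transpose[of S i j v \<xi>] by simp
      qed
    qed
    finally have "I (S, i, j) + I (\<tau> (S, i, j))
        = (\<integral>\<^sup>+\<xi>. pair_weight v S i j \<xi> * (loss S i j (obs S \<xi>) + loss ?S j i (obs S \<xi>)) \<partial>P)"
      using pw[OF t] lo by (simp add: I_def distrib_left nn_integral_add)
    also have "\<dots> \<ge> (\<integral>\<^sup>+\<xi>. \<kappa> * pair_weight v S i j \<xi> \<partial>P)"
    proof (rule nn_integral_mono)
      fix \<xi> assume "\<xi> \<in> space P"
      then have "obs S \<xi> \<in> space (PiM D (\<lambda>_. borel))"
        using measurable_space[OF obs_measurable] by auto
      then show "\<kappa> * pair_weight v S i j \<xi>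
          \<le> pair_weight v S i j \<xi> * (loss S i j (obs S \<xi>) + loss ?S j i (obs S \<xi>))"
        unfolding mult.commute[of \<kappa>] using dich[OF S(1-3)] by (intro mult_left_mono) auto
    qed
    finally show ?thesis .
  qed
  have "(\<Sum>S\<in>sized s. \<integral>\<^sup>+\<xi>. \<kappa> * (of_nat (card (low S \<xi>) * card (high S \<xi>))
              * v (card (low S \<xi>)) (card (high S \<xi>))) \<partial>P)
      = (\<Sum>S\<in>sized s. \<integral>\<^sup>+\<xi>. (\<Sum>i\<in>S. \<Sum>j\<in>D - S. \<kappa> * pair_weight v S i j \<xi>) \<partial>P)"
    using sub by (intro sum.cong refl nn_integral_cong)
      (simp only: sum_distrib_left[symmetric] sum_pair_weight)
  also have "\<dots> = (\<Sum>t\<in>T. case t of (S, i, j) \<Rightarrow> \<integral>\<^sup>+\<xi>. \<kappa> * pair_weight v S i j \<xi> \<partial>P)"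
    unfolding sumT split using pw
    by (intro sum.cong refl swap_sums borel_measurable_times_ennreal borel_measurable_const)
      (auto simp: T_def)
  also have "\<dots> \<le> (\<Sum>t\<in>T. I t + I (\<tau> t))"
    using pairing by (intro sum_mono) auto
  also have "\<dots> = (\<Sum>t\<in>T. I t) + (\<Sum>t\<in>T. I (\<tau> t))"
    by (rule sum.distrib)
  \<comment> \<open>Since \<open>\<tau>\<close> is an involution of \<open>T\<close>, the exchanged
    terms have the same total; this is the source of the factor 2.\<close>
  also have "(\<Sum>t\<in>T. I (\<tau> t)) = (\<Sum>t\<in>T. I t)"
    using \<tau>_T by (intro sum.reindex_bij_witness[of _ \<tau> \<tau>]) auto
  also have "(\<Sum>t\<in>T. I t) = (\<Sum>S\<in>sized s. \<integral>\<^sup>+\<xi>.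
      (\<Sum>i\<in>S. \<Sum>j\<in>D - S. pair_weight v S i j \<xi> * loss S i j (obs S \<xi>)) \<partial>P)"
    unfolding sumT I_def split using pw lo
    by (intro sum.cong refl swap_sums[symmetric] borel_measurable_times_ennreal) (auto simp: T_def)
  also have "\<dots> + \<dots> \<le> (\<Sum>S\<in>sized s. \<integral>\<^sup>+\<xi>. \<rho> S (obs S \<xi>) \<partial>P)
      + (\<Sum>S\<in>sized s. \<integral>\<^sup>+\<xi>. \<rho> S (obs S \<xi>) \<partial>P)"
    using dom by (intro add_mono sum_mono nn_integral_mono) auto
  finally show ?thesis by (simp add: mult_2)
qed

end

subsection \<open>Risk of a selector under the uniform prior\<close>

text \<open>Applied with \<open>m\<close> the product of the two counts, this turns the total weight
  into the indicator that both kinds of confused coordinates occur; at \<open>m = 0\<close> the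
  factor \<open>of_nat m\<close> makes the value 0.\<close>

lemma of_nat_mult_ennreal_inverse:
  "of_nat m * ennreal (1 / real m) = of_bool (m \<noteq> 0)"
  by (simp add: ennreal_of_nat_eq_real_of_nat ennreal_mult'[symmetric])

text \<open>The product of two numbers over their maximum is their minimum; if both are 0, both
  sides vanish.\<close>

lemma of_nat_mult_ennreal_inverse_max:
  "of_nat (m * n) * ennreal (1 / real (max m n)) = of_nat (min m n)"
  by (simp add: ennreal_of_nat_eq_real_of_nat ennreal_mult'[symmetric] max_def min_def
    del: of_nat_mult) auto

text \<open>A distribution is determined by its c.d.f., so the observation law can be computed from
  \<open>M\<close> itself.\<close>

lemma interval_measure_cdf:
  assumes "real_distribution M"
  shows "interval_measure (cdf M) = M"
proof -
  interpret real_distribution M by fact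
  show ?thesis
    by (intro cdf_unique assms real_distribution_interval_measure cdf_interval_measure
      cdf_nondecreasing cdf_is_right_cont cdf_lim_at_bot cdf_lim_at_top_prob)
qed

text \<open>Selectors take values in a discrete space, so an arbitrary loss \<open>f\<close> of the
  answer is measurable.\<close>

lemma selector_loss_measurable:
  assumes "(R, est) \<in> selectors d"
  shows "(\<lambda>\<omega>. f (est \<omega>)) \<in> borel_measurable (PiM {1..d} (\<lambda>_. borel) \<Otimes>\<^sub>M borel)"
    (is "_ \<in> borel_measurable ?M")
proof -
  have "est \<in> ?M \<rightarrow>\<^sub>M count_space ({1..d} \<rightarrow>\<^sub>E {0, 1})"
    using assms by (simp add: selectors_def)
  then show ?thesis by (rule measurable_compose) simp
qed

lemma averaged_loss_measurable:
  assumes "(R, est) \<in> selectors d"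
  shows "(\<lambda>y. \<integral>\<^sup>+u. f (est (y, u)) \<partial>R) \<in> borel_measurable (PiM {1..d} (\<lambda>_. borel))"
proof -
  interpret R: real_distribution R using assms by (simp add: selectors_def)
  have "(\<lambda>\<omega>. f (est \<omega>)) \<in> borel_measurable (PiM {1..d} (\<lambda>_. borel) \<Otimes>\<^sub>M R)"
    using selector_loss_measurable[OF assms, of f]
    by (simp cong: measurable_cong_sets sets_pair_measure_cong)
  then show ?thesis by (rule R.borel_measurable_nn_integral_fst)
qed

lemma slice_measurable:
  assumes "(R, est) \<in> selectors d" "y \<in> space (PiM {1..d} (\<lambda>_. borel))"
  shows "(\<lambda>u. f (est (y, u))) \<in> borel_measurable R"
proof -
  interpret R: real_distribution R using assms by (simp add: selectors_def)
  have "(\<lambda>u. f (est (y, u))) \<in> borel_measurable borel"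
    using assms(2) selector_loss_measurable[OF assms(1), of f] by (rule measurable_compose_Pair1)
  then show ?thesis by simp
qed

text \<open>The signals of the prior: every nonzero mean sits at the smallest height
  allowed.\<close>

definition flat_signal :: "nat \<Rightarrow> real \<Rightarrow> nat set \<Rightarrow> nat \<Rightarrow> real" where
  "flat_signal d a S = (\<lambda>k\<in>{1..d}. a * of_bool (k \<in> S))"

lemma flat_signal_sparse:
  assumes "S \<subseteq> {1..d}" "card S = s"
  shows "flat_signal d a S \<in> sparse_means d s a"
  unfolding sparse_means_def flat_signal_def using assms by (auto intro!: exI[of _ S])

lemma pattern_flat_signal:
  assumes "a \<noteq> 0" "k \<in> {1..d}"
  shows "pattern d (flat_signal d a S) k = of_bool (k \<in> S)"
  using assms by (simp add: pattern_def flat_signal_def)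

lemma supp_pattern_flat_signal:
  assumes "a \<noteq> 0" "S \<subseteq> {1..d}"
  shows "supp d (pattern d (flat_signal d a S)) = S"
  using assms by (auto simp: supp_def pattern_flat_signal)

text \<open>The error event is measurable, so its probability is the integral of a 0-1 loss, the
  same form as the Hamming risk.\<close>

lemma wrong_recovery_prob_eq:
  assumes "(R, est) \<in> selectors d"
  shows "wrong_recovery_prob d \<sigma> (R, est) \<mu> F
    = (\<integral>\<^sup>+\<omega>. of_bool (supp d (est \<omega>) \<noteq> supp d (pattern d \<mu>)) \<partial>(obs_law d \<sigma> \<mu> F \<Otimes>\<^sub>M R))"
proof -
  interpret R: real_distribution R using assms by (simp add: selectors_def)
  let ?M = "obs_law d \<sigma> \<mu> F \<Otimes>\<^sub>M R"
  let ?f = "\<lambda>\<omega>. of_bool (supp d (est \<omega>) \<noteq> supp d (pattern d \<mu>)) :: ennreal"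
  let ?E = "{\<omega> \<in> space ?M. supp d (est \<omega>) \<noteq> supp d (pattern d \<mu>)}"
  have "?f \<in> borel_measurable ?M"
    using selector_loss_measurable[OF assms, of "\<lambda>e. of_bool (supp d e \<noteq> supp d (pattern d \<mu>))"]
    by (simp add: obs_law_def cong: measurable_cong_sets sets_pair_measure_cong)
  then have "?f -` {1} \<inter> space ?M \<in> sets ?M"
    by (rule measurable_sets) simp
  also have "?f -` {1} \<inter> space ?M = ?E"
    by auto
  finally have "emeasure ?M ?E = (\<integral>\<^sup>+\<omega>. indicator ?E \<omega> \<partial>?M)" by simp
  also have "\<dots> = (\<integral>\<^sup>+\<omega>. ?f \<omega> \<partial>?M)"
    by (intro nn_integral_cong) (simp add: indicator_def)
  finally show ?thesis by (simp add: wrong_recovery_prob_def)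
qed

section \<open>Risks at flat signals and their sums over all supports of a given size\<close>

context confusable_noise
begin

lemma obs_law_flat_signal:
  assumes "D = {1..d}"
  shows "obs_law d \<sigma> (flat_signal d a S) (cdf Q) = distr P (PiM D (\<lambda>_. borel)) (obs S)"
  unfolding obs_law_def interval_measure_cdf[OF real_distribution_axioms] flat_signal_def assms[symmetric]
  by (intro distr_cong refl) (simp cong: restrict_cong add: obs_def)

text \<open>By Tonelli the auxiliary randomness is averaged out first. What remains is a function of
  the observation alone, as the exchange bound requires.\<close>

lemma risk_flat_signal:
  assumes D: "D = {1..d}" and sel: "(R, est) \<in> selectors d"
  shows "(\<integral>\<^sup>+\<omega>. f (est \<omega>) \<partial>(obs_law d \<sigma> (flat_signal d a S) (cdf Q) \<Otimes>\<^sub>M R))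
    = (\<integral>\<^sup>+\<xi>. (\<integral>\<^sup>+u. f (est (obs S \<xi>, u)) \<partial>R) \<partial>P)"
proof -
  interpret R: real_distribution R using sel by (simp add: selectors_def)
  let ?L = "distr P (PiM D (\<lambda>_. borel)) (obs S)"
  have "(\<lambda>\<omega>. f (est \<omega>)) \<in> borel_measurable (?L \<Otimes>\<^sub>M R)"
    using selector_loss_measurable[OF sel, of f] D
    by (simp cong: measurable_cong_sets sets_pair_measure_cong)
  from R.nn_integral_fst[OF this]
  have "(\<integral>\<^sup>+\<omega>. f (est \<omega>) \<partial>(?L \<Otimes>\<^sub>M R)) = (\<integral>\<^sup>+y. (\<integral>\<^sup>+u. f (est (y, u)) \<partial>R) \<partial>?L)"
    by simp
  also have "\<dots> = (\<integral>\<^sup>+\<xi>. (\<integral>\<^sup>+u. f (est (obs S \<xi>, u)) \<partial>R) \<partial>P)"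
    using averaged_loss_measurable[OF sel, of f] D
    by (intro nn_integral_distr obs_measurable) simp
  finally show ?thesis by (simp add: obs_law_flat_signal[OF D])
qed

lemma wrong_recovery_flat_signal:
  assumes D: "D = {1..d}" and sel: "(R, est) \<in> selectors d" and "a \<noteq> 0" "S \<subseteq> {1..d}"
  shows "wrong_recovery_prob d \<sigma> (R, est) (flat_signal d a S) (cdf Q)
    = (\<integral>\<^sup>+\<xi>. (\<integral>\<^sup>+u. of_bool (supp d (est (obs S \<xi>, u)) \<noteq> S) \<partial>R) \<partial>P)"
  unfolding wrong_recovery_prob_eq[OF sel] supp_pattern_flat_signal[OF assms(3,4)]
  by (rule risk_flat_signal[OF D sel])

text \<open>No answer equals both \<open>S\<close> and its transposed copy, so the two losses add up
  to at least \<open>\<kappa> = 1\<close>. With weight \<open>1 / (m * n)\<close> the total weight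
  is an indicator, hence at most 1, and the weighted loss stays below the loss.\<close>

lemma wrong_recovery_lower_bound:
  assumes D: "D = {1..d}" and sel: "(R, est) \<in> selectors d" and a: "a \<noteq> 0"
  shows "(\<Sum>S\<in>sized s. \<integral>\<^sup>+\<xi>. of_bool (low S \<xi> \<noteq> {} \<and> high S \<xi> \<noteq> {}) \<partial>P)
    \<le> 2 * (\<Sum>S\<in>sized s. wrong_recovery_prob d \<sigma> (R, est) (flat_signal d a S) (cdf Q))"
proof -
  interpret R: real_distribution R using sel by (simp add: selectors_def)
  define \<psi> where "\<psi> = (\<lambda>S y. \<integral>\<^sup>+u. of_bool (supp d (est (y, u)) \<noteq> S) \<partial>R)"
  let ?v = "\<lambda>m n. ennreal (1 / real (m * n))"
  have sub: "S \<subseteq> D" if "S \<in> sized s" for S using that by (auto simp: sized_def)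
  have weight: "(\<Sum>i\<in>S. \<Sum>j\<in>D - S. pair_weight ?v S i j \<xi>)
      = of_bool (low S \<xi> \<noteq> {} \<and> high S \<xi> \<noteq> {})" if "S \<in> sized s" for S \<xi>
    using sub[OF that] finite_low[of S \<xi>] finite_high[of S \<xi>]
    by (simp add: sum_pair_weight of_nat_mult_ennreal_inverse del: of_nat_mult)
  have "(\<Sum>S\<in>sized s. \<integral>\<^sup>+\<xi>. 1 * (of_nat (card (low S \<xi>) * card (high S \<xi>))
              * ?v (card (low S \<xi>)) (card (high S \<xi>))) \<partial>P)
      \<le> 2 * (\<Sum>S\<in>sized s. \<integral>\<^sup>+\<xi>. \<psi> S (obs S \<xi>) \<partial>P)"
  proof (rule exchange_bound[where loss = "\<lambda>S i j. \<psi> S"])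
    show "\<psi> S \<in> borel_measurable (PiM D (\<lambda>_. borel))" for S
      unfolding \<psi>_def D
      using averaged_loss_measurable[OF sel, of "\<lambda>e. of_bool (supp d e \<noteq> S)"] .
  next
    fix S i j and y :: "nat \<Rightarrow> real"
    assume *: "S \<in> sized s" "i \<in> S" "j \<in> D - S" "y \<in> space (PiM D (\<lambda>_. borel))"
    note meas = slice_measurable[OF sel *(4)[unfolded D], of "\<lambda>e. of_bool (supp d e \<noteq> S')" for S']
    have "1 = (\<integral>\<^sup>+u. 1 \<partial>R)" using R.emeasure_space_1 by simp
    also have "\<dots> \<le> (\<integral>\<^sup>+u. of_bool (supp d (est (y, u)) \<noteq> S)
        + of_bool (supp d (est (y, u)) \<noteq> swap i j ` S) \<partial>R)"
      using transpose_sized(2)[OF *(1-3)] by (intro nn_integral_mono) auto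
    also have "\<dots> = \<psi> S y + \<psi> (swap i j ` S) y"
      unfolding \<psi>_def by (intro nn_integral_add meas)
    finally show "1 \<le> \<psi> S y + \<psi> (swap i j ` S) y" .
  next
    fix S \<xi> assume "S \<in> sized s"
    then show "(\<Sum>i\<in>S. \<Sum>j\<in>D - S. pair_weight ?v S i j \<xi> * \<psi> S (obs S \<xi>)) \<le> \<psi> S (obs S \<xi>)"
      unfolding sum_distrib_right[symmetric] weight[OF \<open>S \<in> sized s\<close>] by simp
  qed
  also have "(\<Sum>S\<in>sized s. \<integral>\<^sup>+\<xi>. \<psi> S (obs S \<xi>) \<partial>P)
      = (\<Sum>S\<in>sized s. wrong_recovery_prob d \<sigma> (R, est) (flat_signal d a S) (cdf Q))"
    unfolding \<psi>_def using sub D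
    by (intro sum.cong refl wrong_recovery_flat_signal[OF D sel a, symmetric]) auto
  also have "(\<Sum>S\<in>sized s. \<integral>\<^sup>+\<xi>. 1 * (of_nat (card (low S \<xi>) * card (high S \<xi>))
              * ?v (card (low S \<xi>)) (card (high S \<xi>))) \<partial>P)
      = (\<Sum>S\<in>sized s. \<integral>\<^sup>+\<xi>. of_bool (low S \<xi> \<noteq> {} \<and> high S \<xi> \<noteq> {}) \<partial>P)"
    using sub weight by (intro sum.cong refl nn_integral_cong) (simp only: sum_pair_weight mult_1)
  finally show ?thesis .
qed

lemma hamming_risk_flat_signal:
  assumes D: "D = {1..d}" and sel: "(R, est) \<in> selectors d" and a: "a \<noteq> 0"
    and S: "S \<subseteq> {1..d}"
  shows "hamming_risk d \<sigma> (R, est) (flat_signal d a S) (cdf Q)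
    = (\<integral>\<^sup>+\<xi>. (\<Sum>k\<in>D. \<integral>\<^sup>+u. of_bool (est (obs S \<xi>, u) k \<noteq> of_bool (k \<in> S)) \<partial>R) \<partial>P)"
proof -
  let ?h = "\<lambda>e. \<Sum>k=1..d. of_bool (e k \<noteq> (of_bool (k \<in> S) :: nat)) :: ennreal"
  have "hamming_risk d \<sigma> (R, est) (flat_signal d a S) (cdf Q)
      = (\<integral>\<^sup>+\<omega>. ?h (est \<omega>) \<partial>(obs_law d \<sigma> (flat_signal d a S) (cdf Q) \<Otimes>\<^sub>M R))"
    unfolding hamming_risk_def split
    by (intro nn_integral_cong) (simp add: hamming_def pattern_flat_signal[OF a])
  also have "\<dots> = (\<integral>\<^sup>+\<xi>. (\<integral>\<^sup>+u. ?h (est (obs S \<xi>, u)) \<partial>R) \<partial>P)"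
    by (rule risk_flat_signal[OF D sel])
  also have "\<dots> = (\<integral>\<^sup>+\<xi>. (\<Sum>k\<in>D.
      \<integral>\<^sup>+u. of_bool (est (obs S \<xi>, u) k \<noteq> of_bool (k \<in> S)) \<partial>R) \<partial>P)"
  proof (rule nn_integral_cong)
    fix \<xi> assume "\<xi> \<in> space P"
    then have "obs S \<xi> \<in> space (PiM {1..d} (\<lambda>_. borel))"
      using measurable_space[OF obs_measurable] D by auto
    note meas = slice_measurable[OF sel this, of "\<lambda>e. of_bool (e k \<noteq> of_bool (k \<in> S))" for k]
    show "(\<integral>\<^sup>+u. ?h (est (obs S \<xi>, u)) \<partial>R)
        = (\<Sum>k\<in>D. \<integral>\<^sup>+u. of_bool (est (obs S \<xi>, u) k \<noteq> of_bool (k \<in> S)) \<partial>R)"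
      using meas unfolding D by (intro nn_integral_sum)
  qed
  finally show ?thesis .
qed

text \<open>The loss of a pair is the error at its signal plus the error at its null. In the
  exchanged configuration the two truths are reversed, so the losses sum to at least
  \<open>\<kappa> = 2\<close>. The weight \<open>1 / max m n\<close> ensures that no coordinate
  error is charged more than once.\<close>

lemma hamming_lower_bound:
  assumes D: "D = {1..d}" and sel: "(R, est) \<in> selectors d" and a: "a \<noteq> 0"
  shows "(\<Sum>S\<in>sized s. \<integral>\<^sup>+\<xi>. of_nat (min (card (low S \<xi>)) (card (high S \<xi>))) \<partial>P)
    \<le> (\<Sum>S\<in>sized s. hamming_risk d \<sigma> (R, est) (flat_signal d a S) (cdf Q))"
proof -
  interpret R: real_distribution R using sel by (simp add: selectors_def)
  define err where "err = (\<lambda>k (b::nat) y. \<integral>\<^sup>+u. of_bool (est (y, u) k \<noteq> b) \<partial>R)"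
  let ?v = "\<lambda>m n. ennreal (1 / real (max m n))"
  let ?loss = "\<lambda>S i j y. err i 1 y + err j 0 y"
  let ?\<rho> = "\<lambda>S y. \<Sum>k\<in>D. err k (of_bool (k \<in> S)) y"
  have sub: "S \<subseteq> D" "finite S" if "S \<in> sized s" for S
    using that finite_D finite_subset by (auto simp: sized_def)
  have err_meas: "err k b \<in> borel_measurable (PiM D (\<lambda>_. borel))" for k b
    unfolding err_def D
    using averaged_loss_measurable[OF sel, of "\<lambda>e. of_bool (e k \<noteq> b)"] .
  have two_answers: "1 \<le> err k 0 y + err k 1 y" if y: "y \<in> space (PiM D (\<lambda>_. borel))" for k y
  proof -
    note meas = slice_measurable[OF sel y[unfolded D], of "\<lambda>e. of_bool (e k \<noteq> b)" for b]
    have "1 = (\<integral>\<^sup>+u. 1 \<partial>R)" using R.emeasure_space_1 by simp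
    also have "\<dots> \<le> (\<integral>\<^sup>+u. of_bool (est (y, u) k \<noteq> 0) + of_bool (est (y, u) k \<noteq> 1) \<partial>R)"
      by (intro nn_integral_mono) auto
    also have "\<dots> = err k 0 y + err k 1 y"
      unfolding err_def by (intro nn_integral_add meas)
    finally show ?thesis .
  qed
  have le1: "of_nat n * ?v m n \<le> 1" "of_nat m * ?v m n \<le> 1" for m n
    by (auto simp: ennreal_of_nat_eq_real_of_nat ennreal_mult'[symmetric] divide_le_eq)
  have "(\<Sum>S\<in>sized s. \<integral>\<^sup>+\<xi>. 2 * (of_nat (card (low S \<xi>) * card (high S \<xi>))
              * ?v (card (low S \<xi>)) (card (high S \<xi>))) \<partial>P)
      \<le> 2 * (\<Sum>S\<in>sized s. \<integral>\<^sup>+\<xi>. ?\<rho> S (obs S \<xi>) \<partial>P)"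
  proof (rule exchange_bound[where loss = ?loss])
    show "?loss S i j \<in> borel_measurable (PiM D (\<lambda>_. borel))" for S i j
      using err_meas by (intro borel_measurable_add)
  next
    fix S i j and y :: "nat \<Rightarrow> real"
    assume "y \<in> space (PiM D (\<lambda>_. borel))"
    \<comment> \<open>The four errors are regrouped by coordinate: each coordinate is wrong for one
      of the truths 0 and 1.\<close>
    from add_mono[OF two_answers[OF this, of i] two_answers[OF this, of j]]
    show "2 \<le> ?loss S i j y + ?loss (swap i j ` S) j i y"
      by (simp add: ac_simps)
  next
    fix S \<xi> assume S: "S \<in> sized s"
    let ?m = "card (low S \<xi>)" and ?n = "card (high S \<xi>)" and ?y = "obs S \<xi>"
    have count: "(\<Sum>j\<in>D - S. of_bool (\<xi> j = x0)) = (of_nat ?n :: ennreal)"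
      "(\<Sum>i\<in>S. of_bool (\<xi> i = - x1)) = (of_nat ?m :: ennreal)"
      using sub[OF S] finite_D
      by (auto simp: low_def high_def Int_def sum_of_bool_eq)
    have signal: "(\<Sum>j\<in>D - S. pair_weight ?v S i j \<xi>) \<le> 1" for i
    proof -
      \<comment> \<open>Dropping the condition on \<open>i\<close> leaves one term per confused
        null, each of weight \<open>1 / max m n\<close>.\<close>
      have "(\<Sum>j\<in>D - S. pair_weight ?v S i j \<xi>)
          \<le> (\<Sum>j\<in>D - S. of_bool (\<xi> j = x0) * ?v ?m ?n)"
        by (intro sum_mono) (auto simp: pair_weight_def)
      also have "\<dots> = of_nat ?n * ?v ?m ?n"
        by (simp only: sum_distrib_right[symmetric] count)
      finally show ?thesis using le1(1) by (rule order_trans)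
    qed
    have null: "(\<Sum>i\<in>S. pair_weight ?v S i j \<xi>) \<le> 1" for j
    proof -
      have "(\<Sum>i\<in>S. pair_weight ?v S i j \<xi>) \<le> (\<Sum>i\<in>S. of_bool (\<xi> i = - x1) * ?v ?m ?n)"
        by (intro sum_mono) (auto simp: pair_weight_def)
      also have "\<dots> = of_nat ?m * ?v ?m ?n"
        by (simp only: sum_distrib_right[symmetric] count)
      finally show ?thesis using le1(2) by (rule order_trans)
    qed
    have "(\<Sum>i\<in>S. \<Sum>j\<in>D - S. pair_weight ?v S i j \<xi> * ?loss S i j ?y)
        = (\<Sum>i\<in>S. \<Sum>j\<in>D - S. pair_weight ?v S i j \<xi> * err i 1 ?y)
          + (\<Sum>i\<in>S. \<Sum>j\<in>D - S. pair_weight ?v S i j \<xi> * err j 0 ?y)"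
      by (simp only: distrib_left sum.distrib)
    also have "(\<Sum>i\<in>S. \<Sum>j\<in>D - S. pair_weight ?v S i j \<xi> * err i 1 ?y)
        = (\<Sum>i\<in>S. (\<Sum>j\<in>D - S. pair_weight ?v S i j \<xi>) * err i 1 ?y)"
      by (simp only: sum_distrib_right)
    also have "\<dots> \<le> (\<Sum>i\<in>S. err i 1 ?y)"
      using signal mult_right_mono[OF signal zero_le] by (intro sum_mono) simp
    also have "(\<Sum>i\<in>S. \<Sum>j\<in>D - S. pair_weight ?v S i j \<xi> * err j 0 ?y)
        = (\<Sum>j\<in>D - S. (\<Sum>i\<in>S. pair_weight ?v S i j \<xi>) * err j 0 ?y)"
      by (subst sum.swap) (simp only: sum_distrib_right)
    also have "\<dots> \<le> (\<Sum>j\<in>D - S. err j 0 ?y)"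
      using null mult_right_mono[OF null zero_le] by (intro sum_mono) simp
    also have "(\<Sum>i\<in>S. err i 1 ?y) + (\<Sum>j\<in>D - S. err j 0 ?y) = ?\<rho> S ?y"
      using sum.subset_diff[OF sub(1)[OF S] finite_D, of "\<lambda>k. err k (of_bool (k \<in> S)) ?y"]
      by (simp add: add.commute)
    finally show "(\<Sum>i\<in>S. \<Sum>j\<in>D - S. pair_weight ?v S i j \<xi> * ?loss S i j ?y) \<le> ?\<rho> S ?y"
      by - (simp add: add_mono)
  qed
  also have "(\<Sum>S\<in>sized s. \<integral>\<^sup>+\<xi>. ?\<rho> S (obs S \<xi>) \<partial>P)
      = (\<Sum>S\<in>sized s. hamming_risk d \<sigma> (R, est) (flat_signal d a S) (cdf Q))"
    unfolding err_def using sub D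
    by (intro sum.cong refl hamming_risk_flat_signal[OF D sel a, symmetric]) auto
  also have "(\<Sum>S\<in>sized s. \<integral>\<^sup>+\<xi>. 2 * (of_nat (card (low S \<xi>) * card (high S \<xi>))
              * ?v (card (low S \<xi>)) (card (high S \<xi>))) \<partial>P)
      = 2 * (\<Sum>S\<in>sized s. \<integral>\<^sup>+\<xi>. of_nat (min (card (low S \<xi>)) (card (high S \<xi>))) \<partial>P)"
    unfolding of_nat_mult_ennreal_inverse_max sum_distrib_left
    using sub card_low_measurable
    by (intro sum.cong refl nn_integral_cmult) measurable
  finally show ?thesis by (simp add: ennreal_mult_le_mult_iff)
qed

end

subsection \<open>Number of confused coordinates\<close>

text \<open>Blocks are removed greedily: after one block of size \<open>n\<close> is taken out of
  \<open>T\<close>, enough elements remain for the other members of \<open>S\<close>.\<close>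

lemma disjoint_blocks:
  assumes "finite S" "finite T" "card S * n \<le> card T"
  shows "\<exists>B. (\<forall>i\<in>S. B i \<subseteq> T \<and> card (B i) = n) \<and> disjoint_family_on B S"
  using assms
proof (induction S arbitrary: T rule: finite_induct)
  case empty
  then show ?case by (simp add: disjoint_family_on_def)
next
  case (insert i S)
  have "n \<le> card T" using insert by simp
  then obtain C where C: "C \<subseteq> T" "card C = n" "finite C"
    by (rule obtain_subset_with_card_n)
  have "card S * n \<le> card (T - C)"
    using insert C by (simp add: card_Diff_subset)
  with insert.IH[of "T - C"] insert.prems obtain B
    where B: "\<forall>k\<in>S. B k \<subseteq> T - C \<and> card (B k) = n" "disjoint_family_on B S" by auto
  show ?case
  proof (intro exI[of _ "B(i := C)"] conjI)
    show "\<forall>k\<in>insert i S. (B(i := C)) k \<subseteq> T \<and> card ((B(i := C)) k) = n"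
      using B C by auto
    show "disjoint_family_on (B(i := C)) (insert i S)"
      using B C insert.hyps unfolding disjoint_family_on_def by (auto; blast)
  qed
qed

lemma of_bool_measurable:
  assumes "Measurable.pred M \<phi>"
  shows "(\<lambda>\<xi>. of_bool (\<phi> \<xi>) :: ennreal) \<in> borel_measurable M"
  by (rule measurable_compose[OF assms]) simp

section \<open>Probabilities of coordinate events under the product law\<close>

context confusable_noise
begin

lemma emeasure_box:
  assumes "J \<subseteq> D" "\<And>k. k \<in> J \<Longrightarrow> E k \<in> sets borel"
  shows "emeasure P {\<xi> \<in> space P. \<forall>k\<in>J. \<xi> k \<in> E k} = ennreal (\<Prod>k\<in>J. prob (E k))"
proof -
  interpret prod: product_prob_space "\<lambda>_. Q" D ..
  have "emeasure P {\<xi> \<in> space P. \<forall>k\<in>J. \<xi> k \<in> E k} = (\<Prod>k\<in>J. emeasure Q (E k))"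
    using assms finite_D by (intro prod.emeasure_PiM_Collect) (auto intro: finite_subset)
  then show ?thesis
    by (simp add: emeasure_eq_measure prod_ennreal)
qed

lemma sets_box:
  assumes "J \<subseteq> D" "\<And>k. k \<in> J \<Longrightarrow> E k \<in> sets borel"
  shows "{\<xi> \<in> space P. \<forall>k\<in>J. \<xi> k \<in> E k} \<in> sets P"
proof (rule sets.sets_Collect_finite_All)
  show "finite J" using assms(1) finite_D by (rule finite_subset)
next
  fix k assume "k \<in> J"
  with assms have "k \<in> D" "E k \<in> sets borel" by auto
  from measurable_sets[OF coordinate_measurable[OF this(1)] this(2)]
  show "{\<xi> \<in> space P. \<xi> k \<in> E k} \<in> sets P"
    by (simp add: vimage_def Int_def conj_commute)
qed

lemma nn_integral_box:
  assumes "J \<subseteq> D" "\<And>k. k \<in> J \<Longrightarrow> E k \<in> sets borel"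
  shows "(\<integral>\<^sup>+\<xi>. of_bool (\<forall>k\<in>J. \<xi> k \<in> E k) \<partial>P) = ennreal (\<Prod>k\<in>J. prob (E k))"
proof -
  have "(\<integral>\<^sup>+\<xi>. of_bool (\<forall>k\<in>J. \<xi> k \<in> E k) \<partial>P)
      = (\<integral>\<^sup>+\<xi>. indicator {\<xi> \<in> space P. \<forall>k\<in>J. \<xi> k \<in> E k} \<xi> \<partial>P)"
    by (intro nn_integral_cong) (simp add: indicator_def)
  also have "\<dots> = emeasure P {\<xi> \<in> space P. \<forall>k\<in>J. \<xi> k \<in> E k}"
    using sets_box[OF assms] by (rule nn_integral_indicator)
  finally show ?thesis using emeasure_box[OF assms] by simp
qed

lemma prob_compl_singleton: "prob (- {c}) = 1 - prob {c}"
  using prob_compl[of "{c}"] by (simp add: Compl_eq_Diff_UNIV)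

lemma nn_integral_avoid:
  assumes "J \<subseteq> D"
  shows "(\<integral>\<^sup>+\<xi>. of_bool (\<forall>k\<in>J. \<xi> k \<noteq> c) \<partial>P) = ennreal ((1 - prob {c}) ^ card J)"
  using nn_integral_box[OF assms, of "\<lambda>_. - {c}"] by (simp add: prob_compl_singleton)

lemma coordinate_event_measurable:
  assumes "J \<subseteq> D"
  shows "Measurable.pred P (\<lambda>\<xi>. \<forall>k\<in>J. \<xi> k \<noteq> c)"
  using sets_box[OF assms, of "\<lambda>_. - {c}"] by (simp add: pred_def)

text \<open>A union bound over the two failures, kept in additive form because subtraction on
  \<open>ennreal\<close> is truncated.\<close>

lemma low_and_high_likely:
  assumes "S \<subseteq> D"
  shows "1 \<le> (\<integral>\<^sup>+\<xi>. of_bool (low S \<xi> \<noteq> {} \<and> high S \<xi> \<noteq> {}) \<partial>P)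
    + ennreal ((1 - prob {- x1}) ^ card S) + ennreal ((1 - prob {x0}) ^ card (D - S))"
proof -
  interpret P: prob_space P by (rule prob_space_PiM) (rule prob_space_axioms)
  have no_low: "low S \<xi> = {} \<longleftrightarrow> (\<forall>k\<in>S. \<xi> k \<noteq> - x1)"
    and no_high: "high S \<xi> = {} \<longleftrightarrow> (\<forall>k\<in>D - S. \<xi> k \<noteq> x0)" for \<xi>
    by (auto simp: low_def high_def)
  note [measurable] = coordinate_event_measurable[OF assms, of "- x1"]
    coordinate_event_measurable[of "D - S" x0, OF Diff_subset]
  have "1 = (\<integral>\<^sup>+\<xi>. 1 \<partial>P)" by (simp add: P.emeasure_space_1)
  also have "\<dots> \<le> (\<integral>\<^sup>+\<xi>. of_bool (low S \<xi> \<noteq> {} \<and> high S \<xi> \<noteq> {})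
      + of_bool (\<forall>k\<in>S. \<xi> k \<noteq> - x1) + of_bool (\<forall>k\<in>D - S. \<xi> k \<noteq> x0) \<partial>P)"
    unfolding no_low no_high by (intro nn_integral_mono) auto
  also have "\<dots> = (\<integral>\<^sup>+\<xi>. of_bool (low S \<xi> \<noteq> {} \<and> high S \<xi> \<noteq> {}) \<partial>P)
      + (\<integral>\<^sup>+\<xi>. of_bool (\<forall>k\<in>S. \<xi> k \<noteq> - x1) \<partial>P)
      + (\<integral>\<^sup>+\<xi>. of_bool (\<forall>k\<in>D - S. \<xi> k \<noteq> x0) \<partial>P)"
  proof -
    have m: "(\<lambda>\<xi>. of_bool (low S \<xi> \<noteq> {} \<and> high S \<xi> \<noteq> {}) :: ennreal) \<in> borel_measurable P"
      "(\<lambda>\<xi>. of_bool (\<forall>k\<in>S. \<xi> k \<noteq> - x1) :: ennreal) \<in> borel_measurable P"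
      "(\<lambda>\<xi>. of_bool (\<forall>k\<in>D - S. \<xi> k \<noteq> x0) :: ennreal) \<in> borel_measurable P"
      unfolding no_low no_high by (intro of_bool_measurable; measurable)+
    then show ?thesis
      by (simp only: nn_integral_add borel_measurable_add)
  qed
  finally show ?thesis
    by (simp only: nn_integral_avoid[OF assms] nn_integral_avoid[OF Diff_subset])
qed

text \<open>The probability that \<open>i\<close> is confused is split according to whether the
  block contains a confused null; independence gives the part where it contains none.\<close>

lemma low_hits_block:
  assumes "i \<in> D" "B \<subseteq> D" "i \<notin> B"
  shows "ennreal (prob {- x1} * (1 - (1 - prob {x0}) ^ card B))
    \<le> (\<integral>\<^sup>+\<xi>. of_bool (\<xi> i = - x1 \<and> (\<exists>j\<in>B. \<xi> j = x0)) \<partial>P)" (is "_ \<le> ?I")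
proof -
  let ?q = "(1 - prob {x0}) ^ card B"
  have fin: "finite B" using assms(2) finite_D by (rule finite_subset)
  note [measurable] = coordinate_event_measurable[OF assms(2)] coordinate_eq_measurable[OF assms(1)]
  have hit: "(\<integral>\<^sup>+\<xi>. of_bool (\<xi> i = - x1) \<partial>P) = ennreal (prob {- x1})"
    using nn_integral_box[of "{i}" "\<lambda>_. {- x1}"] assms by simp
  have miss: "(\<integral>\<^sup>+\<xi>. of_bool (\<xi> i = - x1 \<and> (\<forall>j\<in>B. \<xi> j \<noteq> x0)) \<partial>P) = ennreal (prob {- x1} * ?q)"
  proof -
    \<comment> \<open>Because \<open>i\<close> lies outside \<open>B\<close>, both conditions
      together form one box on \<open>insert i B\<close>.\<close>
    let ?E = "\<lambda>k. if k = i then {- x1} else - {x0}"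
    have "(\<integral>\<^sup>+\<xi>. of_bool (\<xi> i = - x1 \<and> (\<forall>j\<in>B. \<xi> j \<noteq> x0)) \<partial>P)
        = (\<integral>\<^sup>+\<xi>. of_bool (\<forall>k\<in>insert i B. \<xi> k \<in> ?E k) \<partial>P)"
      using assms by (intro nn_integral_cong arg_cong[where f = of_bool]) auto
    also have "\<dots> = ennreal (\<Prod>k\<in>insert i B. prob (?E k))"
      using assms by (intro nn_integral_box) auto
    also have "(\<Prod>k\<in>insert i B. prob (?E k)) = prob {- x1} * (\<Prod>k\<in>B. prob (- {x0}))"
      using assms fin by (subst prod.insert) (auto intro!: prod.cong simp del: prod_constant)
    finally show ?thesis by (simp add: prob_compl_singleton)
  qed
  have "(\<integral>\<^sup>+\<xi>. of_bool (\<xi> i = - x1) \<partial>P)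
      \<le> (\<integral>\<^sup>+\<xi>. of_bool (\<xi> i = - x1 \<and> \<not> (\<forall>j\<in>B. \<xi> j \<noteq> x0))
          + of_bool (\<xi> i = - x1 \<and> (\<forall>j\<in>B. \<xi> j \<noteq> x0)) \<partial>P)"
    by (intro nn_integral_mono) auto
  also have "\<dots> = (\<integral>\<^sup>+\<xi>. of_bool (\<xi> i = - x1 \<and> \<not> (\<forall>j\<in>B. \<xi> j \<noteq> x0)) \<partial>P)
      + (\<integral>\<^sup>+\<xi>. of_bool (\<xi> i = - x1 \<and> (\<forall>j\<in>B. \<xi> j \<noteq> x0)) \<partial>P)"
    by (rule nn_integral_add) (intro of_bool_measurable; measurable)+
  finally have "ennreal (prob {- x1}) \<le> ?I + ennreal (prob {- x1} * ?q)"
    by (simp add: hit miss)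
  then have "ennreal (prob {- x1}) - ennreal (prob {- x1} * ?q) \<le> ?I"
    by (simp add: ennreal_minus_le_iff add.commute)
  then show ?thesis
    by (simp add: ennreal_minus right_diff_distrib)
qed

text \<open>Each signal of \<open>low S\<close> is matched to a null of its own block, so the number of successful
  blocks bounds both counts from below.\<close>

lemma expected_min_lower_bound:
  assumes S: "S \<subseteq> D" and n: "card S * n \<le> card (D - S)"
  shows "ennreal (real (card S) * (prob {- x1} * (1 - (1 - prob {x0}) ^ n)))
    \<le> (\<integral>\<^sup>+\<xi>. of_nat (min (card (low S \<xi>)) (card (high S \<xi>))) \<partial>P)"
proof -
  have fin: "finite S" using S finite_D by (rule finite_subset)
  obtain B where B_all: "\<forall>i\<in>S. B i \<subseteq> D - S \<and> card (B i) = n" and disj: "disjoint_family_on B S"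
    using disjoint_blocks[OF fin finite_Diff[OF finite_D] n] by (elim exE conjE)
  have B: "B i \<subseteq> D - S" "card (B i) = n" if "i \<in> S" for i
    using bspec[OF B_all that] by simp_all
  have count: "card {i\<in>S. \<xi> i = - x1 \<and> (\<exists>j\<in>B i. \<xi> j = x0)}
      \<le> min (card (low S \<xi>)) (card (high S \<xi>))" for \<xi>
  proof -
    let ?M = "{i\<in>S. \<xi> i = - x1 \<and> (\<exists>j\<in>B i. \<xi> j = x0)}"
    \<comment> \<open>\<open>m\<close> picks a confused null in the block of each successful signal;
      disjoint blocks make it injective.\<close>
    define m where "m = (\<lambda>i. SOME j. j \<in> B i \<and> \<xi> j = x0)"
    have m: "m i \<in> B i \<and> \<xi> (m i) = x0" if "i \<in> ?M" for i
      unfolding m_def by (rule someI_ex) (use that in blast)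
    have "inj_on m ?M"
    proof (rule inj_onI)
      fix i k assume *: "i \<in> ?M" "k \<in> ?M" "m i = m k"
      have "m i \<in> B i \<inter> B k" using m[OF *(1)] m[OF *(2)] *(3) by simp
      then have "B i \<inter> B k \<noteq> {}" by blast
      moreover have "i \<in> S" "k \<in> S" using * by simp_all
      ultimately show "i = k" using disj unfolding disjoint_family_on_def by metis
    qed
    moreover have "m ` ?M \<subseteq> high S \<xi>"
    proof (rule image_subsetI)
      fix i assume i: "i \<in> ?M"
      then have "m i \<in> D - S" using m[OF i] B(1)[of i] by blast
      then show "m i \<in> high S \<xi>" using m[OF i] by (simp add: high_def)
    qed
    ultimately have "card ?M \<le> card (high S \<xi>)"
      using finite_high by (rule card_inj_on_le)
    moreover have "card ?M \<le> card (low S \<xi>)"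
      using finite_low[OF S] by (intro card_mono) (auto simp: low_def)
    ultimately show ?thesis by simp
  qed
  have "ennreal (real (card S) * (prob {- x1} * (1 - (1 - prob {x0}) ^ n)))
      = (\<Sum>i\<in>S. ennreal (prob {- x1} * (1 - (1 - prob {x0}) ^ n)))"
    by (simp add: ennreal_of_nat_eq_real_of_nat ennreal_mult')
  also have "\<dots> \<le> (\<Sum>i\<in>S. \<integral>\<^sup>+\<xi>. of_bool (\<xi> i = - x1 \<and> (\<exists>j\<in>B i. \<xi> j = x0)) \<partial>P)"
  proof (rule sum_mono)
    fix i assume "i \<in> S"
    with B(1)[OF this] S have "i \<in> D" "B i \<subseteq> D" "i \<notin> B i" by auto
    from low_hits_block[OF this] B(2)[OF \<open>i \<in> S\<close>]
    show "ennreal (prob {- x1} * (1 - (1 - prob {x0}) ^ n))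
        \<le> (\<integral>\<^sup>+\<xi>. of_bool (\<xi> i = - x1 \<and> (\<exists>j\<in>B i. \<xi> j = x0)) \<partial>P)" by simp
  qed
  also have "\<dots> = (\<integral>\<^sup>+\<xi>. (\<Sum>i\<in>S. of_bool (\<xi> i = - x1 \<and> (\<exists>j\<in>B i. \<xi> j = x0))) \<partial>P)"
  proof (rule nn_integral_sum[symmetric])
    fix i assume "i \<in> S"
    with B(1)[OF this] S have "i \<in> D" "B i \<subseteq> D" by auto
    note [measurable] = coordinate_eq_measurable[OF this(1)] coordinate_event_measurable[OF this(2)]
    have "Measurable.pred P (\<lambda>\<xi>. \<xi> i = - x1 \<and> \<not> (\<forall>j\<in>B i. \<xi> j \<noteq> x0))"
      by measurable
    from of_bool_measurable[OF this]
    show "(\<lambda>\<xi>. of_bool (\<xi> i = - x1 \<and> (\<exists>j\<in>B i. \<xi> j = x0)) :: ennreal) \<in> borel_measurable P"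
      by simp
  qed
  also have "\<dots> \<le> (\<integral>\<^sup>+\<xi>. of_nat (min (card (low S \<xi>)) (card (high S \<xi>))) \<partial>P)"
  proof (rule nn_integral_mono)
    fix \<xi>
    have "(\<Sum>i\<in>S. of_bool (\<xi> i = - x1 \<and> (\<exists>j\<in>B i. \<xi> j = x0)))
        = (of_nat (card {i\<in>S. \<xi> i = - x1 \<and> (\<exists>j\<in>B i. \<xi> j = x0)}) :: ennreal)"
      using fin by (subst sum_of_bool_eq) (auto simp: Int_def)
    then show "(\<Sum>i\<in>S. of_bool (\<xi> i = - x1 \<and> (\<exists>j\<in>B i. \<xi> j = x0)))
        \<le> (of_nat (min (card (low S \<xi>)) (card (high S \<xi>))) :: ennreal)"
      using count[of \<xi>] by (simp only: of_nat_le_iff)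
  qed
  finally show ?thesis .
qed

end

subsection \<open>The least favourable noise\<close>

text \<open>The atom at 0 takes the remaining mass. The upper tail equals \<open>p0\<close> below
  \<open>x0\<close> and 0 from there on, so its decreasing bound is tightest at the atom; the lower
  tail behaves likewise with \<open>p1\<close> and \<open>x1\<close>, except at
  \<open>u = 0\<close>, where the bound is 1.\<close>

lemma three_point_noise:
  fixes \<nu> x0 x1 p0 p1 :: real
  assumes pos: "0 < x0" "0 < x1" "0 \<le> p0" "0 \<le> p1" "p0 + p1 \<le> 1" "0 < \<nu>"
    and p0: "p0 \<le> exp (- (x0 powr \<nu>) / \<nu>)" and p1: "p1 \<le> exp (- (x1 powr \<nu>) / \<nu>)"
  shows "\<exists>Q. real_distribution Q \<and> cdf Q \<in> cdf_class \<nu> \<and>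
    measure Q {x0} = p0 \<and> measure Q {- x1} = p1"
proof -
  let ?xs = "[(x0, p0), (- x1, p1), (0, 1 - p0 - p1)]"
  let ?pmf = "measure_pmf (pmf_of_list ?xs)"
  define Q where "Q = distr ?pmf borel id"
  have wf: "pmf_of_list_wf ?xs"
    using pos by (intro pmf_of_list_wfI) auto
  have meas: "measure Q E = sum_list (map snd (filter (\<lambda>x. fst x \<in> E) ?xs))"
    if "E \<in> sets borel" for E
    using that by (simp only: measure_pmf_of_list[OF wf, symmetric])
      (simp add: Q_def measure_distr)
  have Q: "real_distribution Q"
    unfolding Q_def by (rule prob_space.real_distribution_distr) (simp_all add: prob_space_measure_pmf)
  have tail: "p \<le> exp (- (\<bar>u\<bar> powr \<nu>) / \<nu>)"
    if "p \<le> exp (- (x powr \<nu>) / \<nu>)" "0 \<le> u" "u \<le> x" for p u x :: real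
  proof -
    have "u powr \<nu> \<le> x powr \<nu>" using that pos by (intro powr_mono2) auto
    then have "exp (- (x powr \<nu>) / \<nu>) \<le> exp (- (\<bar>u\<bar> powr \<nu>) / \<nu>)"
      using that pos by (simp add: divide_right_mono)
    with that show ?thesis by linarith
  qed
  have "1 - cdf Q u \<le> exp (- (\<bar>u\<bar> powr \<nu>) / \<nu>)" if "0 \<le> u" for u
    using that pos tail[OF p0, of u] by (auto simp: cdf_def meas)
  moreover have "cdf Q (- u) \<le> exp (- (\<bar>u\<bar> powr \<nu>) / \<nu>)" if "0 \<le> u" for u
    using that pos tail[OF p1, of u] by (auto simp: cdf_def meas)
  ultimately have "cdf Q \<in> cdf_class \<nu>"
    using Q by (auto simp: cdf_class_def)
  moreover have "measure Q {x0} = p0" "measure Q {- x1} = p1"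
    using pos by (auto simp: meas)
  ultimately show ?thesis using Q by blast
qed

lemma ln_ge_imp_gt_one: "exp 1 \<le> t \<Longrightarrow> 1 \<le> ln t \<and> 1 < (t::real)"
  using exp_gt_one[of "1::real"] ln_ge_iff[of t 1] by linarith

text \<open>This keeps each mass \<open>ln t / t\<close> at most 1/2. For \<open>x = ln t\<close>
  nonnegative, the quadratic Taylor bound gives
  \<open>exp x - 2 * x \<ge> ((x - 1)\<^sup>2 + 1) / 2\<close>.\<close>

lemma ln_le_half: "0 < t \<Longrightarrow> ln t \<le> t / (2::real)"
proof -
  assume "0 < t"
  have "ln t \<le> exp (ln t) / 2"
  proof (cases "ln t < 0")
    case False
    with exp_lower_Taylor_quadratic[of "ln t"] zero_le_square[of "ln t - 1"] show ?thesis
      by (simp add: power2_eq_square algebra_simps)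
  next
    case True
    then show ?thesis using exp_ge_zero[of "ln t"] by linarith
  qed
  with \<open>0 < t\<close> show ?thesis by simp
qed

text \<open>For \<open>t \<ge> exp 1\<close>, the point where the tail bound
  \<open>exp (- (x powr \<nu>) / \<nu>)\<close> equals \<open>ln t / t\<close>. It is the term of
  the theorem with \<open>c = \<nu>\<close>.\<close>

definition quantile :: "real \<Rightarrow> real \<Rightarrow> real" where
  "quantile \<nu> t = (\<nu> * ln t - \<nu> * ln (ln t)) powr (1 / \<nu>)"

lemma quantile:
  fixes \<nu> t :: real
  assumes \<nu>: "0 < \<nu>" and t: "exp 1 \<le> t"
  shows "0 < quantile \<nu> t" "exp (- (quantile \<nu> t powr \<nu>) / \<nu>) = ln t / t"
proof -
  have ln: "1 \<le> ln t" "1 < t" using ln_ge_imp_gt_one[OF t] by auto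
  have "ln (ln t) < ln t"
    using ln ln_le_half[of t] by (subst ln_less_cancel_iff) auto
  then have pos: "0 < \<nu> * ln t - \<nu> * ln (ln t)" using \<nu> by simp
  then show "0 < quantile \<nu> t"
    unfolding quantile_def powr_gt_zero by (rule less_imp_neq[THEN not_sym])
  have "quantile \<nu> t powr \<nu> = \<nu> * (ln t - ln (ln t))"
  proof -
    have "quantile \<nu> t powr \<nu> = (\<nu> * ln t - \<nu> * ln (ln t)) powr 1"
      using \<nu> by (simp add: quantile_def powr_powr)
    also have "\<dots> = \<nu> * (ln t - ln (ln t))"
      using powr_one[OF less_imp_le[OF pos]] by (simp only: right_diff_distrib)
    finally show ?thesis .
  qed
  then have "- (quantile \<nu> t powr \<nu>) / \<nu> = ln (ln t) - ln t"
    using \<nu> by simp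
  then show "exp (- (quantile \<nu> t powr \<nu>) / \<nu>) = ln t / t"
    using ln by (simp add: exp_diff)
qed

text \<open>The two quantiles are shrunk by a common factor until they produce the shift
  \<open>a\<close> exactly. Moving atoms towards 0 only loosens the tail bound at them, so the
  masses can stay the same.\<close>

lemma confusing_noise:
  fixes \<nu> \<sigma> a t0 t1 :: real
  assumes "0 < \<nu>" "0 < \<sigma>" "0 < a" "exp 1 \<le> t0" "exp 1 \<le> t1"
    and a: "a < \<sigma> * (quantile \<nu> t0 + quantile \<nu> t1)"
  shows "\<exists>Q x0 x1. real_distribution Q \<and> cdf Q \<in> cdf_class \<nu> \<and> a = \<sigma> * (x0 + x1) \<and>
    measure Q {x0} = ln t0 / t0 \<and> measure Q {- x1} = ln t1 / t1"
proof -
  let ?q = "quantile \<nu>"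
  define r where "r = a / (\<sigma> * (?q t0 + ?q t1))"
  have q: "0 < ?q t0" "0 < ?q t1" using quantile(1) assms by auto
  have "0 < \<sigma> * (?q t0 + ?q t1)" using q assms by simp
  then have "0 < r" "r \<le> 1" "r * (\<sigma> * (?q t0 + ?q t1)) = a"
    using assms by (auto simp: r_def)
  then have r: "0 < r" "r \<le> 1" "a = \<sigma> * (r * ?q t0 + r * ?q t1)"
    by (auto simp: algebra_simps)
  \<comment> \<open>The bound 1/2 on each mass leaves a nonnegative mass for the atom at 0.\<close>
  have t: "0 \<le> ln t / t" "ln t / t \<le> 1 / 2" if "exp 1 \<le> t" for t :: real
    using ln_ge_imp_gt_one[OF that] ln_le_half[of t] by (auto simp: field_simps)
  have le: "ln t / t \<le> exp (- ((r * ?q t) powr \<nu>) / \<nu>)" if "exp 1 \<le> t" for t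
  proof -
    have "0 < ?q t" using quantile(1) assms that by auto
    then have "(r * ?q t) powr \<nu> \<le> ?q t powr \<nu>"
      using r assms by (intro powr_mono2) (auto simp: mult_le_cancel_right1)
    then have "exp (- (?q t powr \<nu>) / \<nu>) \<le> exp (- ((r * ?q t) powr \<nu>) / \<nu>)"
      using assms by (simp add: divide_right_mono)
    then show ?thesis using quantile(2)[OF assms(1) that] by linarith
  qed
  have "\<exists>Q. real_distribution Q \<and> cdf Q \<in> cdf_class \<nu> \<and>
      measure Q {r * ?q t0} = ln t0 / t0 \<and> measure Q {- (r * ?q t1)} = ln t1 / t1"
    using assms q r t le add_mono[OF t(2) t(2), of t0 t1] by (intro three_point_noise) auto
  with r(3) show ?thesis by blast
qed

lemma avoid_bound:
  assumes "0 \<le> p" "p \<le> 1" "c \<le> real n * p"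
  shows "(1 - p) ^ n \<le> exp (- c)"
proof -
  have "(1 - p) ^ n \<le> exp (- p) ^ n"
    using assms exp_ge_add_one_self[of "- p"] by (intro power_mono) auto
  also have "\<dots> = exp (- (real n * p))"
    by (simp add: exp_of_nat_mult[symmetric])
  also have "\<dots> \<le> exp (- c)" using assms by simp
  finally show ?thesis .
qed

text \<open>Half of \<open>1 - 2 * exp (- 3)\<close> exceeds the target constant. With
  \<open>x = exp (- 1)\<close> at most 2/5, the left side is at most \<open>2 - 2.88 * x\<close>,
  and \<open>x \<ge> 100 / 272\<close> makes this at most 1.\<close>

lemma numeric_bound:
  "2 * (1 - exp (- 1))\<^sup>2 + 2 * exp (- 3) \<le> (1::real)"
proof -
  define x :: real where "x = exp (- 1)"
  have x3: "exp (- 3) = x ^ 3" by (simp add: x_def exp_of_nat_mult[symmetric])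
  have "5 / 2 \<le> exp (1::real)" using exp_lower_Taylor_quadratic[of 1] by simp
  then have "x \<le> 2 / 5" "100 / 272 \<le> x"
    using e_less_272 by (auto simp: x_def exp_minus field_simps)
  then have "x\<^sup>2 \<le> 2 / 5 * x" "x ^ 3 \<le> 4 / 25 * x"
    using mult_right_mono[of x "2/5" x] mult_right_mono[of "x * x" "2/5 * (2/5)" x] mult_mono[of x "2/5" x "2/5"]
    by (auto simp: power2_eq_square power3_eq_cube)
  with \<open>100 / 272 \<le> x\<close> show ?thesis
    unfolding x3 x_def[symmetric] by (simp add: power2_diff)
qed

subsection \<open>Minimax bounds\<close>

lemma ln_ge_of_exp_less: "exp c < x \<Longrightarrow> c \<le> ln (x::real)"
  using exp_gt_zero[of c] ln_ge_iff[of x c] by linarith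

lemma ennreal_average_le:
  fixes x y :: ennreal
  assumes "finite A" "A \<noteq> {}" "of_nat (card A) * x \<le> of_nat (card A) * y"
  shows "x \<le> y"
  using assms by (subst (asm) ennreal_mult_le_mult_iff) auto

lemma sup_risk_lower:
  assumes "cdf Q \<in> cdf_class \<nu>" "S \<subseteq> {1..d}" "card S = s"
  shows "r (flat_signal d a S) (cdf Q) \<le> (SUP F\<in>cdf_class \<nu>. SUP \<mu>\<in>sparse_means d s a. r \<mu> F :: ennreal)"
  by (rule SUP_upper2[OF assms(1)], rule SUP_upper, rule flat_signal_sparse[OF assms(2,3)])

context confusable_noise
begin

lemma sized_nonempty: "s \<le> card D \<Longrightarrow> sized s \<noteq> {}"
  using obtain_subset_with_card_n[of s D] by (auto simp: sized_def)

lemma sizedD: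
  assumes "S \<in> sized s"
  shows "S \<subseteq> D" "card S = s" "finite S" "card (D - S) = card D - s"
proof -
  show "S \<subseteq> D" "card S = s" using assms by (auto simp: sized_def)
  then show "finite S" using finite_D by (blast intro: finite_subset)
  with \<open>S \<subseteq> D\<close> \<open>card S = s\<close> show "card (D - S) = card D - s"
    by (simp add: card_Diff_subset)
qed

text \<open>The worst case dominates the average over supports, and each support fails to have both
  kinds of confused coordinates with probability at most \<open>2 * exp (- 3)\<close>. The constant
  3 is chosen to meet \<open>numeric_bound\<close>.\<close>

lemma wrong_recovery_minimax:
  assumes D: "D = {1..d}" and s: "s \<le> d" and a: "0 < a" and F: "cdf Q \<in> cdf_class \<nu>"
    and \<eta>: "\<eta> \<in> selectors d"
    and low_p: "(1 - prob {- x1}) ^ s \<le> exp (- 3)"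
    and high_p: "(1 - prob {x0}) ^ (d - s) \<le> exp (- 3)"
  shows "ennreal ((1 - exp (- 1))\<^sup>2)
    \<le> (SUP F\<in>cdf_class \<nu>. SUP \<mu>\<in>sparse_means d s a. wrong_recovery_prob d \<sigma> \<eta> \<mu> F)" (is "_ \<le> ?V")
proof -
  obtain R est where \<eta>_eq: "\<eta> = (R, est)" by (cases \<eta>)
  let ?I = "\<lambda>S. \<integral>\<^sup>+\<xi>. of_bool (low S \<xi> \<noteq> {} \<and> high S \<xi> \<noteq> {}) \<partial>P"
  let ?W = "\<lambda>S. wrong_recovery_prob d \<sigma> \<eta> (flat_signal d a S) (cdf Q)"
  let ?C = "of_nat (card (sized s)) :: ennreal"
  have nonempty: "sized s \<noteq> {}" using sized_nonempty[of s] s D by simp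
  have S: "S \<subseteq> D" "card S = s" "card (D - S) = d - s" if "S \<in> sized s" for S
    using sizedD[OF that] D by simp_all
  have "1 \<le> ?I S + ennreal (2 * exp (- 3))" if "S \<in> sized s" for S
  proof -
    have "1 \<le> ?I S + (ennreal ((1 - prob {- x1}) ^ s) + ennreal ((1 - prob {x0}) ^ (d - s)))"
      using low_and_high_likely[OF S(1)[OF that]] S[OF that] by (simp add: add.assoc)
    also have "\<dots> \<le> ?I S + (ennreal (exp (- 3)) + ennreal (exp (- 3)))"
      using low_p high_p by (intro add_left_mono add_mono ennreal_leI)
    finally show ?thesis by (simp add: ennreal_plus[symmetric] del: ennreal_plus)
  qed
  then have "(\<Sum>S\<in>sized s. 1) \<le> (\<Sum>S\<in>sized s. ?I S + ennreal (2 * exp (- 3)))"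
    by (intro sum_mono)
  then have "?C * 1 \<le> (\<Sum>S\<in>sized s. ?I S) + ?C * ennreal (2 * exp (- 3))"
    by (simp add: sum.distrib)
  also have "\<dots> \<le> 2 * (?C * ?V) + ?C * ennreal (2 * exp (- 3))"
  proof (rule add_right_mono)
    have "(\<Sum>S\<in>sized s. ?I S) \<le> 2 * (\<Sum>S\<in>sized s. ?W S)"
      using wrong_recovery_lower_bound[OF D \<eta>[unfolded \<eta>_eq]] a \<eta>_eq by simp
    also have "(\<Sum>S\<in>sized s. ?W S) \<le> (\<Sum>S\<in>sized s. ?V)"
      using S D by (intro sum_mono sup_risk_lower F) auto
    finally show "(\<Sum>S\<in>sized s. ?I S) \<le> 2 * (?C * ?V)" by (simp add: mult_left_mono)
  qed
  also have "\<dots> = ?C * (2 * ?V + ennreal (2 * exp (- 3)))"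
    by (simp only: distrib_left ac_simps)
  finally have "?C * 1 \<le> ?C * (2 * ?V + ennreal (2 * exp (- 3)))" .
  then have bound: "1 \<le> 2 * ?V + ennreal (2 * exp (- 3))"
    by (rule ennreal_average_le[OF finite_sized nonempty])
  show ?thesis
  \<comment> \<open>The inequality can be solved for the worst-case risk only when that is finite;
    otherwise the claim is immediate.\<close>
  proof (cases ?V rule: ennreal_cases)
    case (real v)
    then have "ennreal 1 \<le> ennreal (2 * v + 2 * exp (- 3))"
      using bound by (simp add: ennreal_mult')
    then have "1 \<le> 2 * v + 2 * exp (- 3)"
      using real by (subst (asm) ennreal_le_iff) auto
    then show ?thesis
      unfolding real(2) using numeric_bound by (intro ennreal_leI) linarith
  next
    case top
    show ?thesis unfolding top by (rule top_greatest)
  qed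
qed

text \<open>\<open>n\<close> is the number of nulls reserved for each signal. The expected minimum
  is at least \<open>s * \<beta>\<close>, and normalisation by \<open>1 / s\<close> leaves
  \<open>\<beta>\<close>.\<close>

lemma hamming_minimax:
  assumes D: "D = {1..d}" and s: "1 \<le> s" "s * n \<le> d - s" "s \<le> d" and a: "0 < a"
    and F: "cdf Q \<in> cdf_class \<nu>" and \<eta>: "\<eta> \<in> selectors d"
    and \<beta>: "\<beta> \<le> prob {- x1} * (1 - (1 - prob {x0}) ^ n)"
  shows "ennreal \<beta> \<le> (SUP F\<in>cdf_class \<nu>. SUP \<mu>\<in>sparse_means d s a.
    ennreal (1 / real s) * hamming_risk d \<sigma> \<eta> \<mu> F)" (is "_ \<le> ?V")
proof -
  obtain R est where \<eta>_eq: "\<eta> = (R, est)" by (cases \<eta>)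
  let ?I = "\<lambda>S. \<integral>\<^sup>+\<xi>. of_nat (min (card (low S \<xi>)) (card (high S \<xi>))) \<partial>P"
  let ?H = "\<lambda>S. hamming_risk d \<sigma> \<eta> (flat_signal d a S) (cdf Q)"
  let ?C = "of_nat (card (sized s)) :: ennreal"
  have nonempty: "sized s \<noteq> {}" using sized_nonempty[of s] s D by simp
  have S: "S \<subseteq> D" "card S = s" "card (D - S) = d - s" if "S \<in> sized s" for S
    using sizedD[OF that] D by simp_all
  have "ennreal \<beta> \<le> ennreal (1 / real s) * ?I S" if "S \<in> sized s" for S
  proof -
    have "ennreal \<beta> = ennreal (1 / real s) * ennreal (real s * \<beta>)"
      using s by (simp add: ennreal_mult'[symmetric])
    also have "\<dots> \<le> ennreal (1 / real s) * ennreal (real s * (prob {- x1} * (1 - (1 - prob {x0}) ^ n)))"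
      using \<beta> by (intro mult_left_mono ennreal_leI) auto
    also have "\<dots> \<le> ennreal (1 / real s) * ?I S"
      using expected_min_lower_bound[OF S(1)[OF that], of n] S[OF that] s
      by (intro mult_left_mono) auto
    finally show ?thesis .
  qed
  then have "?C * ennreal \<beta> \<le> (\<Sum>S\<in>sized s. ennreal (1 / real s) * ?I S)"
    by (rule sum_bounded_below)
  also have "\<dots> \<le> ennreal (1 / real s) * (\<Sum>S\<in>sized s. ?H S)"
    unfolding sum_distrib_left[symmetric]
    using hamming_lower_bound[OF D \<eta>[unfolded \<eta>_eq]] a \<eta>_eq by (intro mult_left_mono) auto
  also have "\<dots> = (\<Sum>S\<in>sized s. ennreal (1 / real s) * ?H S)"
    by (rule sum_distrib_left)
  also have "\<dots> \<le> (\<Sum>S\<in>sized s. ?V)"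
  proof (rule sum_mono)
    fix S assume "S \<in> sized s"
    then show "ennreal (1 / real s) * ?H S \<le> ?V"
      using S D by (intro sup_risk_lower[where r = "\<lambda>\<mu> F. ennreal (1 / real s) * hamming_risk d \<sigma> \<eta> \<mu> F"] F) auto
  qed
  finally have "?C * ennreal \<beta> \<le> ?C * ?V" by simp
  then show ?thesis
    by (rule ennreal_average_le[OF finite_sized nonempty])
qed

end

text \<open>Pointwise, two different supports force at least one disagreeing coordinate.\<close>

lemma wrong_recovery_le_hamming_risk:
  assumes "\<eta> \<in> selectors d"
  shows "wrong_recovery_prob d \<sigma> \<eta> \<mu> F \<le> hamming_risk d \<sigma> \<eta> \<mu> F"
proof -
  obtain R est where \<eta>: "\<eta> = (R, est)" by (cases \<eta>)
  have "of_bool (supp d e \<noteq> supp d e') \<le> (of_nat (hamming d e e') :: ennreal)" for e e'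
  proof (cases "supp d e = supp d e'")
    case False
    have "supp d e = supp d e'" if "\<forall>k\<in>{1..d}. e k = e' k"
      using that by (simp add: supp_def cong: conj_cong)
    with False obtain k where k: "k \<in> {1..d}" "e k \<noteq> e' k" by blast
    then have "of_bool (e k \<noteq> e' k) \<le> hamming d e e'"
      unfolding hamming_def by (intro member_le_sum) auto
    then have "1 \<le> hamming d e e'" using k by simp
    from of_nat_mono[OF this, where ?'a = ennreal] show ?thesis using False by simp
  qed simp
  then show ?thesis
    unfolding \<eta> wrong_recovery_prob_eq[OF assms[unfolded \<eta>]] hamming_risk_def split
    by (intro nn_integral_mono)
qed

lemma exact_recovery_lower_bound:
  fixes \<nu> \<sigma> a :: real and d s :: nat
  assumes pos: "0 < \<nu>" "0 < \<sigma>" "0 < a" and s: "s < d"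
    and large: "exp 3 < min (real d - real s) (real s)"
    and a: "a < \<sigma> * (quantile \<nu> (real d - real s) + quantile \<nu> (real s))"
  shows "ennreal ((1 - exp (- 1))\<^sup>2)
    \<le> (INF \<eta>\<in>selectors d. SUP F\<in>cdf_class \<nu>. SUP \<mu>\<in>sparse_means d s a. wrong_recovery_prob d \<sigma> \<eta> \<mu> F)"
proof (rule INF_greatest)
  fix \<eta> assume \<eta>: "\<eta> \<in> selectors d"
  let ?t = "real d - real s"
  have t_eq: "real (d - s) = ?t" using s by (simp add: of_nat_diff)
  have "exp 1 \<le> exp (3::real)" by simp
  then have ge: "exp 1 \<le> ?t" "exp 1 \<le> real s"
    using large unfolding min_less_iff_conj by linarith+
  obtain Q x0 x1 where Q: "real_distribution Q" "cdf Q \<in> cdf_class \<nu>" "a = \<sigma> * (x0 + x1)"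
    "measure Q {x0} = ln ?t / ?t" "measure Q {- x1} = ln (real s) / real s"
    using confusing_noise[OF pos ge a] by (elim exE conjE)
  interpret confusable_noise Q "{1..d}" \<sigma> a x0 x1
    using Q(1,3) by (intro confusable_noise.intro confusable_noise_axioms.intro finite_atLeastAtMost)
  have ln: "3 \<le> ln ?t" "3 \<le> ln (real s)"
    using large by (auto intro: ln_ge_of_exp_less)
  have nz: "?t \<noteq> 0" "real s \<noteq> 0"
    using ge exp_gt_zero[of "1::real"] by linarith+
  \<comment> \<open>With \<open>t\<close> coordinates and mass \<open>ln t / t\<close>, the expected
    number of confused ones is \<open>ln t\<close>, which exceeds 3 once
    \<open>t > exp 3\<close>.\<close>
  have "3 \<le> real s * prob {- x1}" "3 \<le> real (d - s) * prob {x0}"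
    unfolding Q(4,5) t_eq using ln nz by simp_all
  from avoid_bound[OF measure_nonneg prob_le_1 this(1)] avoid_bound[OF measure_nonneg prob_le_1 this(2)]
  show "ennreal ((1 - exp (- 1))\<^sup>2)
      \<le> (SUP F\<in>cdf_class \<nu>. SUP \<mu>\<in>sparse_means d s a. wrong_recovery_prob d \<sigma> \<eta> \<mu> F)"
    by (rule wrong_recovery_minimax[OF refl less_imp_le[OF s] pos(3) Q(2) \<eta>])
qed

lemma hamming_risk_lower_bound:
  fixes \<nu> \<sigma> a A :: real and d s :: nat
  assumes pos: "0 < \<nu>" "0 < \<sigma>" "0 < a" and s: "1 \<le> s" "s < d"
    and large: "exp 3 < min (real d / real s - 1) A"
    and a: "a < \<sigma> * (quantile \<nu> (real d / real s - 1) + quantile \<nu> A)"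
  shows "ennreal ((1 - exp (- 1)) / A)
    \<le> (INF \<eta>\<in>selectors d. SUP F\<in>cdf_class \<nu>. SUP \<mu>\<in>sparse_means d s a.
          ennreal (1 / real s) * hamming_risk d \<sigma> \<eta> \<mu> F)"
proof (rule INF_greatest)
  fix \<eta> assume \<eta>: "\<eta> \<in> selectors d"
  define t where "t = real d / real s - 1"
  \<comment> \<open>There are \<open>t\<close> nulls per signal on average, so rounding down allows
    disjoint blocks of size \<open>n\<close>.\<close>
  define n where "n = nat \<lfloor>t\<rfloor>"
  have large': "exp 3 < t" "exp 3 < A" using large by (simp_all add: t_def)
  have "exp 1 \<le> exp (3::real)" by simp
  then have ge: "exp 1 \<le> t" "exp 1 \<le> A"
    using large' by linarith+
  obtain Q x0 x1 where Q: "real_distribution Q" "cdf Q \<in> cdf_class \<nu>" "a = \<sigma> * (x0 + x1)"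
    "measure Q {x0} = ln t / t" "measure Q {- x1} = ln A / A"
    using confusing_noise[OF pos ge a[folded t_def]] by (elim exE conjE)
  interpret confusable_noise Q "{1..d}" \<sigma> a x0 x1
    using Q(1,3) by (intro confusable_noise.intro confusable_noise_axioms.intro finite_atLeastAtMost)
  have ln: "3 \<le> ln t" "1 \<le> ln A"
    using large' ln_ge_of_exp_less ln_ge_imp_gt_one[OF ge(2)] by auto
  have t2: "2 \<le> t" using large' exp_ge_add_one_self[of "3::real"] by linarith
  have A_pos: "0 < A" using large' exp_gt_zero[of "3::real"] by linarith
  have n: "real n \<le> t" "t - 1 \<le> real n"
    using t2 by (simp_all add: n_def)
  have "real s * real n \<le> real s * t" using n by (intro mult_left_mono) auto
  also have "\<dots> = real (d - s)" using s by (simp add: t_def right_diff_distrib of_nat_diff)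
  finally have "real (s * n) \<le> real (d - s)" by simp
  then have blocks: "s * n \<le> d - s" by (simp only: of_nat_le_iff)
  \<comment> \<open>Since \<open>t \<ge> 2\<close>, rounding costs at most a factor 2, which
    \<open>ln t \<ge> 3\<close> absorbs: a block contains at least one confused null in
    expectation.\<close>
  have "1 \<le> (1 / 2) * ln t" using ln by simp
  also have "\<dots> \<le> (real n / t) * ln t"
    using n t2 ln by (intro mult_right_mono) (simp_all add: le_divide_eq)
  finally have "1 \<le> real n * prob {x0}" by (simp add: Q(4))
  then have miss: "(1 - prob {x0}) ^ n \<le> exp (- 1)"
    by (rule avoid_bound[OF measure_nonneg prob_le_1])
  \<comment> \<open>A signal is confused with probability at least \<open>1 / A\<close>, its block
    succeeds with probability at least \<open>1 - exp (- 1)\<close>, and the two events are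
    independent.\<close>
  have "1 / A * (1 - exp (- 1)) \<le> ln A / A * (1 - (1 - prob {x0}) ^ n)"
  proof (rule mult_mono)
    show "1 / A \<le> ln A / A" by (rule divide_right_mono[OF ln(2) less_imp_le[OF A_pos]])
    show "0 \<le> ln A / A" using ln(2) A_pos by (intro divide_nonneg_pos) linarith+
    show "1 - exp (- 1) \<le> 1 - (1 - prob {x0}) ^ n" "0 \<le> 1 - exp (- (1::real))" using miss by simp_all
  qed
  then have "(1 - exp (- 1)) / A \<le> prob {- x1} * (1 - (1 - prob {x0}) ^ n)"
    by (simp add: Q(5))
  then show "ennreal ((1 - exp (- 1)) / A)
      \<le> (SUP F\<in>cdf_class \<nu>. SUP \<mu>\<in>sparse_means d s a.
            ennreal (1 / real s) * hamming_risk d \<sigma> \<eta> \<mu> F)"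
    by (rule hamming_minimax[OF refl s(1) blocks less_imp_le[OF s(2)] pos(3) Q(2) \<eta>])
qed

theorem theorem9:
  fixes \<nu> :: real
  assumes "\<nu> > 1"
  shows "\<exists>c c' :: real. c > 0 \<and> c' > 0 \<and>
    c' \<ge> (LEAST t. t \<ge> exp 1 \<and> \<nu> * ln t > c * ln (ln t)) \<and>
    (\<forall>(\<sigma>::real) (a::real) (d::nat) (s::nat). \<sigma> > 0 \<longrightarrow> a > 0 \<longrightarrow> d > 2 \<longrightarrow> 1 \<le> s \<longrightarrow> s < d \<longrightarrow>
      (min (real d - real s) (real s) > c' \<longrightarrow>
       a < \<sigma> * ((\<nu> * ln (real d - real s) - c * ln (ln (real d - real s))) powr (1 / \<nu>)
               + (\<nu> * ln (real s) - c * ln (ln (real s))) powr (1 / \<nu>)) \<longrightarrow>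
       (INF \<eta>\<in>selectors d. SUP F\<in>cdf_class \<nu>. SUP \<mu>\<in>sparse_means d s a. hamming_risk d \<sigma> \<eta> \<mu> F)
         \<ge> (INF \<eta>\<in>selectors d. SUP F\<in>cdf_class \<nu>. SUP \<mu>\<in>sparse_means d s a.
               wrong_recovery_prob d \<sigma> \<eta> \<mu> F) \<and>
       (INF \<eta>\<in>selectors d. SUP F\<in>cdf_class \<nu>. SUP \<mu>\<in>sparse_means d s a.
               wrong_recovery_prob d \<sigma> \<eta> \<mu> F)
         \<ge> ennreal ((1 - exp (- 1))\<^sup>2)) \<and>
      (\<forall>A::real. A > 1 \<longrightarrow> min (real d / real s - 1) A > c' \<longrightarrow>
       a < \<sigma> * ((\<nu> * ln (real d / real s - 1) - c * ln (ln (real d / real s - 1))) powr (1 / \<nu>)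
               + (\<nu> * ln A - c * ln (ln A)) powr (1 / \<nu>)) \<longrightarrow>
       (INF \<eta>\<in>selectors d. SUP F\<in>cdf_class \<nu>. SUP \<mu>\<in>sparse_means d s a.
               ennreal (1 / real s) * hamming_risk d \<sigma> \<eta> \<mu> F)
         \<ge> ennreal ((1 - exp (- 1)) / A)))"
\<comment> \<open>\<open>c = \<nu>\<close> turns both terms in the bound on \<open>a\<close> into
  quantiles; \<open>c' = exp 3\<close> makes every logarithm of a large parameter at least
  3.\<close>
proof (rule exI[of _ \<nu>], rule exI[of _ "exp 3"], intro conjI allI impI, goal_cases)
  case 1
  show ?case using assms by simp
next
  case 2
  show ?case by simp
next
  case 3
  \<comment> \<open>With \<open>c = \<nu>\<close> the condition reads
    \<open>ln (ln t) < ln t\<close>. It already holds at \<open>t = exp 1\<close>, where it says 0 <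
    1, so the minimum is attained at the left end.\<close>
  have "(LEAST t. exp 1 \<le> t \<and> \<nu> * ln (ln t) < \<nu> * ln t) = exp 1"
    using assms by (intro Least_equality) auto
  then show ?case by simp
next
  case 4
  show ?case
    by (rule INF_superset_mono[OF order_refl], rule SUP_subset_mono[OF order_refl],
        rule SUP_subset_mono[OF order_refl], rule wrong_recovery_le_hamming_risk)
next
  case 5
  have "0 < \<nu>" using assms by simp
  from exact_recovery_lower_bound[unfolded quantile_def, OF this 5(1,2,5,6,7)] show ?case .
next
  case 6
  have "0 < \<nu>" using assms by simp
  from hamming_risk_lower_bound[unfolded quantile_def, OF this 6(1,2,4,5,7,8)] show ?case .
qed

end
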